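(* Let $m\ge 2$ and let $$K^\ast_{\ell_1} = \operatorname{cl}\{\mathbf{s}=(\mathbf{s}_1,\ldots,\mathbf{s}_m)\in\mathbb{R}^{U\times m} : \Lambda(\mathbf{s}_1)\succ 0,\ \Lambda(\mathbf{s}_1)-\Lambda(\mathbf{s}_i)\Lambda(\mathbf{s}_1)^{-1}\Lambda(\mathbf{s}_i)\succ 0\ \ \forall i\in\{2,\ldots,m\}\}.$$ Then the function $$F(\mathbf{s}) = -\sum_{i=2}^m \log\det\big(\Lambda(\mathbf{s}_1)-\Lambda(\mathbf{s}_i)\Lambda(\mathbf{s}_1)^{-1}\Lambda(\mathbf{s}_i)\big) - \log\det\Lambda(\mathbf{s}_1),$$ defined on the set where all these matrices are positive definite (the interior of $K^\ast_{\ell_1}$), is an $Lm$-logarithmically homogeneous self-concordant barrier for $K^\ast_{\ell_1}$.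
   Context: Fix integers $n,d\ge 1$, and set $L=\binom{n+d}{n}$, $U=\binom{n+2d}{n}$. Let $\mathbf{t}_1,\ldots,\mathbf{t}_U\in\mathbb{R}^n$ be points that are unisolvent for $\mathbb{R}[\mathbf{x}]_{n,2d}$ (the polynomials in $n$ variables of degree at most $2d$), i.e. a polynomial of degree at most $2d$ vanishing at all of them is zero, and let $p_1,\ldots,p_L$ be a basis of $\mathbb{R}[\mathbf{x}]_{n,d}$. Let $\mathbf{P}\in\mathbb{R}^{U\times L}$ with $P_{u,\ell}=p_\ell(\mathbf{t}_u)$, and define the linear map $\Lambda:\mathbb{R}^U\to\mathbb{S}^L$ by $\Lambda(\mathbf{s})=\mathbf{P}^\top\operatorname{Diag}(\mathbf{s})\mathbf{P}$, where $\mathbb{S}^L$ denotes the real symmetric $L\times L$ matrices. A function $F$ on the interior of a closed convex cone $K$ with nonempty interior is a $\nu$-logarithmically homogeneous self-concordant barrier ($\nu$-LHSCB) if it is $C^3$ and convex, $F(\mathbf{x}_k)\to\infty$ whenever $\mathbf{x}_k$ converges to a point on the boundary of $K$, $|D^3F(\mathbf{x})[\mathbf{h},\mathbf{h},\mathbf{h}]|\le 2\,(D^2F(\mathbf{x})[\mathbf{h},\mathbf{h}])^{3/2}$ for all interior $\mathbf{x}$ and all directions $\mathbf{h}$, and $F(\tau\mathbf{x})=F(\mathbf{x})-\nu\log\tau$ for all $\tau>0$. *)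

theory Defs
  imports "HOL-Analysis.Analysis"
begin

definition poly_fun_deg :: "nat \<Rightarrow> (real^'n \<Rightarrow> real) \<Rightarrow> bool" where
  "poly_fun_deg k f \<longleftrightarrow>
     (\<exists>c :: ('n \<Rightarrow> nat) \<Rightarrow> real.
        f = (\<lambda>x. \<Sum>\<alpha>\<in>{\<alpha>. sum \<alpha> UNIV \<le> k}. c \<alpha> * (\<Prod>i\<in>UNIV. (x $ i) ^ \<alpha> i)))"

definition unisolvent :: "nat \<Rightarrow> ('u \<Rightarrow> real^'n) \<Rightarrow> bool" where
  "unisolvent k t \<longleftrightarrow>
     (\<forall>f. poly_fun_deg k f \<longrightarrow> (\<forall>u. f (t u) = 0) \<longrightarrow> f = (\<lambda>_. 0))"

definition poly_basis :: "nat \<Rightarrow> ('l::finite \<Rightarrow> real^'n \<Rightarrow> real) \<Rightarrow> bool" where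
  "poly_basis k p \<longleftrightarrow>
     (\<forall>l. poly_fun_deg k (p l)) \<and>
     (\<forall>c. (\<lambda>x. \<Sum>l\<in>UNIV. c l * p l x) = (\<lambda>_. 0) \<longrightarrow> (\<forall>l. c l = 0)) \<and>
     (\<forall>f. poly_fun_deg k f \<longrightarrow> (\<exists>c. f = (\<lambda>x. \<Sum>l\<in>UNIV. c l * p l x)))"

definition pos_def :: "real^'l^'l \<Rightarrow> bool" where
  "pos_def A \<longleftrightarrow> transpose A = A \<and> (\<forall>x. x \<noteq> 0 \<longrightarrow> x \<bullet> (A *v x) > 0)"

definition Pmat :: "('u \<Rightarrow> real^'n) \<Rightarrow> ('l \<Rightarrow> real^'n \<Rightarrow> real) \<Rightarrow> real^'l^'u" where
  "Pmat t p = (\<chi> u l. p l (t u))"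

definition Lam :: "('u::finite \<Rightarrow> real^'n) \<Rightarrow> ('l::finite \<Rightarrow> real^'n \<Rightarrow> real) \<Rightarrow> real^'u \<Rightarrow> real^'l^'l" where
  "Lam t p s = transpose (Pmat t p) ** (\<chi> i j. if i = j then s $ i else 0) ** Pmat t p"

definition schur :: "('u::finite \<Rightarrow> real^'n) \<Rightarrow> ('l::finite \<Rightarrow> real^'n \<Rightarrow> real) \<Rightarrow> real^'u \<Rightarrow> real^'u \<Rightarrow> real^'l^'l" where
  "schur t p s1 si = Lam t p s1 - Lam t p si ** matrix_inv (Lam t p s1) ** Lam t p si"

text \<open>The open set where all the matrices are positive definite; s = (s_i), i ranging over 'm,
  with distinguished index i1 playing the role of 1.\<close>
definition Kdom :: "('u::finite \<Rightarrow> real^'n) \<Rightarrow> ('l::finite \<Rightarrow> real^'n \<Rightarrow> real) \<Rightarrow> 'm::finite \<Rightarrow> (real^'u^'m) set" where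
  "Kdom t p i1 = {s. pos_def (Lam t p (s $ i1)) \<and>
                     (\<forall>i. i \<noteq> i1 \<longrightarrow> pos_def (schur t p (s $ i1) (s $ i)))}"

definition Kdual :: "('u::finite \<Rightarrow> real^'n) \<Rightarrow> ('l::finite \<Rightarrow> real^'n \<Rightarrow> real) \<Rightarrow> 'm::finite \<Rightarrow> (real^'u^'m) set" where
  "Kdual t p i1 = closure (Kdom t p i1)"

definition Fbar :: "('u::finite \<Rightarrow> real^'n) \<Rightarrow> ('l::finite \<Rightarrow> real^'n \<Rightarrow> real) \<Rightarrow> 'm::finite \<Rightarrow> real^'u^'m \<Rightarrow> real" where
  "Fbar t p i1 s =
     - (\<Sum>i\<in>UNIV - {i1}. ln (det (schur t p (s $ i1) (s $ i)))) - ln (det (Lam t p (s $ i1)))"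

definition LHSCB :: "'a::euclidean_space set \<Rightarrow> ('a \<Rightarrow> real) \<Rightarrow> real \<Rightarrow> bool" where
  "LHSCB K F \<nu> \<longleftrightarrow>
     closed K \<and> convex K \<and> cone K \<and> interior K \<noteq> {} \<and>
     (\<exists>D1 D2 (D3 :: 'a \<Rightarrow> 'a \<Rightarrow>\<^sub>L 'a \<Rightarrow>\<^sub>L 'a \<Rightarrow>\<^sub>L real).
        (\<forall>x\<in>interior K.
           (F has_derivative blinfun_apply (D1 x)) (at x) \<and>
           (D1 has_derivative blinfun_apply (D2 x)) (at x) \<and>
           (D2 has_derivative blinfun_apply (D3 x)) (at x)) \<and>
        continuous_on (interior K) D3 \<and>
        (\<forall>x\<in>interior K. \<forall>h.
           \<bar>blinfun_apply (blinfun_apply (blinfun_apply (D3 x) h) h) h\<bar>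
             \<le> 2 * (blinfun_apply (blinfun_apply (D2 x) h) h) powr (3/2))) \<and>
     convex_on (interior K) F \<and>
     (\<forall>X x. (\<forall>k. X k \<in> interior K) \<longrightarrow> X \<longlonglongrightarrow> x \<longrightarrow> x \<in> frontier K \<longrightarrow>
            filterlim (\<lambda>k. F (X k)) at_top sequentially) \<and>
     (\<forall>x\<in>interior K. \<forall>\<tau>>0. F (\<tau> *\<^sub>R x) = F x - \<nu> * ln \<tau>)"

end

theory Submission
  imports Defs
begin

text \<open>
  Write A for the matrix of the distinguished component and B for that of another one. Since
  A - B A^-1 B = (A - B) A^-1 (A + B), the domain is cut out by A + B > 0 and A - B > 0, and the
  barrier is a combination of functions -log det of linear maps, with a negative coefficient at
  -log det A when there are more than two components. Hence its derivatives are traces of powers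
  of X^-1 x.

  For self-concordance, the direction (x, y) at (X, Y) = (A + B, A - B) is written as one symmetric
  matrix H in coordinates where diag(X, Y) is the identity and whose leading block is the direction
  of A alone, of Frobenius norm \<alpha>. If the other diagonal block has norm \<sigma> and the two
  off-diagonal blocks contribute w to the squared norm of H, then removing the contribution of A
  leaves \<sigma>^2 + w in the second derivative and at most 2 \<sigma>^3 + 3 (\<sigma> + \<alpha>) w in the third. With
  M^2 = \<alpha>^2 + \<sigma>^2 + w and z = \<alpha> + \<sigma>, summation over the components reduces the claim to
  3 z M^2 - z^3 \<le> 2 M^3, that is, (z - M)^2 (z + 2 M) \<ge> 0.
\<close>

section \<open>Matrix calculus\<close>

text \<open>The function \<open>Fbar\<close> is the sum of -log det (A + B) - log det (A - B) over
  the m - 1 other components, plus (m - 2) log det A. Adding the parameters of the first terms would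
  give 2 (m - 1) L; the value m L is due to the last term. That term is concave for m > 2, so
  neither convexity nor self-concordance follows term by term: each pair has to absorb one copy of
  -log det A, and one further copy is kept. The coordinates come from two ways to diagonalise ((A,
  B), (B, A)). The orthogonal substitution (u + v, u - v) / sqrt 2 gives diag(A + B, A - B); block
  elimination gives diag(A, S) with S the Schur complement. The first explains the powers of X^-1 x,
  the second isolates the direction of A in a diagonal block. That block is the same for all
  components, which is why a single \<alpha> serves in the whole sum. At the boundary the terms of
  opposite sign could compensate each other. The blow-up is therefore proved on the original
  expression, where all logarithms have the same sign.\<close>

lemma matrix_inv_right: "det (A::real^'n^'n) \<noteq> 0 \<Longrightarrow> A ** matrix_inv A = mat 1"
  and matrix_inv_left: "det (A::real^'n^'n) \<noteq> 0 \<Longrightarrow> matrix_inv A ** A = mat 1"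
  unfolding matrix_inv_def invertible_det_nz[symmetric] invertible_def by (metis (mono_tags, lifting) someI_ex)+

lemma matrix_inv_eqI:
  fixes A B :: "real^'n^'n"
  assumes "A ** B = mat 1"
  shows "matrix_inv A = B"
proof -
  have "det A \<noteq> 0"
    using assms by (metis det_I det_mul mult_zero_left zero_neq_one)
  then have "matrix_inv A ** (A ** B) = B"
    by (simp add: matrix_mul_assoc matrix_inv_left)
  with assms show ?thesis by simp
qed

lemma matrix_minus_mult: "(- A) ** B = - (A ** (B::real^'p^'n))"
  and matrix_mult_minus: "A ** (- B) = - (A ** (B::real^'p^'n))"
  by (simp_all add: matrix_matrix_mult_def vec_eq_iff sum_negf)

lemma matrix_diff_ldistrib: "A ** (B - C) = A ** B - A ** (C::real^'p^'n)"
  and matrix_diff_rdistrib: "(D - E) ** F = D ** F - E ** (F::real^'p^'n)"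
  by (simp_all add: matrix_matrix_mult_def vec_eq_iff sum_subtractf algebra_simps)

lemma matrix_add_rdistrib: "(A + B) ** C = A ** C + B ** (C::real^'p^'n)"
  by (simp add: matrix_matrix_mult_def vec_eq_iff sum.distrib algebra_simps)

lemma matrix_mult_scaleR: "A ** (c *\<^sub>R B) = c *\<^sub>R (A ** (B::real^'p^'n))"
  and matrix_scaleR_mult: "(c *\<^sub>R A) ** B = c *\<^sub>R (A ** (B::real^'p^'n))"
  by (simp_all add: matrix_matrix_mult_def vec_eq_iff sum_distrib_left algebra_simps)

lemma transpose_add: "transpose (A + B) = transpose A + transpose B"
  and transpose_diff: "transpose (C - D) = transpose C - (transpose D :: real^'n^'m)"
  and transpose_minus: "transpose (- E) = - (transpose E :: real^'n^'m)"
  by (simp_all add: transpose_def vec_eq_iff)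

lemma trace_scaleR: "trace (c *\<^sub>R A) = c * trace (A::real^'n^'n)"
  by (simp add: trace_def sum_distrib_left)

lemma trace_uminus: "trace (- A) = - trace (A::real^'n^'n)"
  by (simp add: trace_def sum_negf)

text \<open>The norm of a nested vector is the Frobenius norm, and every matrix norm below is meant
  in this sense.\<close>

lemma norm_matrix_sq: "(norm (A::real^'n^'m))\<^sup>2 = (\<Sum>i\<in>UNIV. \<Sum>j\<in>UNIV. (A$i$j)\<^sup>2)"
  unfolding power2_norm_eq_inner inner_vec_def by (simp add: power2_eq_square)

lemma norm_matrix_sq_trace: "(norm (A::real^'n^'m))\<^sup>2 = trace (A ** transpose A)"
  unfolding norm_matrix_sq trace_def by (simp add: matrix_matrix_mult_def transpose_def power2_eq_square)

lemma norm_transpose: "norm (transpose A) = norm (A::real^'n^'m)"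
proof -
  have "(norm (transpose A))\<^sup>2 = (norm A)\<^sup>2"
    unfolding norm_matrix_sq by (simp add: transpose_def) (rule sum.swap)
  then show ?thesis by simp
qed

lemma norm_sq_rows: "(norm (A::real^'n^'m))\<^sup>2 = (\<Sum>i\<in>UNIV. (norm (A$i))\<^sup>2)"
  unfolding power2_norm_eq_inner inner_vec_def[of A] ..

text \<open>Each entry of the product is a row of A times a column of B, so Cauchy-Schwarz applies
  entrywise and the double sum factors.\<close>

lemma norm_matrix_mult_le: "norm (A ** B) \<le> norm (A::real^'n^'m) * norm (B::real^'p^'n)"
proof (rule power2_le_imp_le)
  have "(norm (A ** B))\<^sup>2 = (\<Sum>i\<in>UNIV. \<Sum>j\<in>UNIV. (A $ i \<bullet> transpose B $ j)\<^sup>2)"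
    by (simp add: norm_matrix_sq matrix_matrix_mult_def inner_vec_def transpose_def)
  also have "\<dots> \<le> (\<Sum>i\<in>UNIV. \<Sum>j\<in>UNIV. (norm (A $ i))\<^sup>2 * (norm (transpose B $ j))\<^sup>2)"
    by (intro sum_mono) (metis Cauchy_Schwarz_ineq power2_norm_eq_inner)
  also have "\<dots> = (norm A)\<^sup>2 * (norm (transpose B))\<^sup>2"
    by (simp only: norm_sq_rows sum_product)
  finally show "(norm (A ** B))\<^sup>2 \<le> (norm A * norm B)\<^sup>2"
    by (simp add: norm_transpose power_mult_distrib)
qed simp

text \<open>Cauchy-Schwarz for the Frobenius inner product.\<close>

lemma abs_trace_mult_le: "\<bar>trace (A ** B)\<bar> \<le> norm (A::real^'n^'m) * norm (B::real^'m^'n)"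
proof -
  have "trace (A ** B) = A \<bullet> transpose B"
    by (simp add: trace_def matrix_matrix_mult_def transpose_def inner_vec_def)
  then show ?thesis
    using Cauchy_Schwarz_ineq2[of A "transpose B"] by (simp add: norm_transpose)
qed

lemma bounded_bilinear_matrix_mult:
  "bounded_bilinear ((**) :: real^'n^'m \<Rightarrow> real^'p^'n \<Rightarrow> real^'p^'m)"
  by (rule bounded_bilinear.intro)
    (auto simp: matrix_add_ldistrib matrix_add_rdistrib matrix_scaleR_mult matrix_mult_scaleR
      intro!: exI[of _ 1] norm_matrix_mult_le)

lemmas has_derivative_matrix_mult [derivative_intros] =
  bounded_bilinear.FDERIV[OF bounded_bilinear_matrix_mult]
lemmas continuous_on_matrix_mult [continuous_intros] =
  bounded_bilinear.continuous_on[OF bounded_bilinear_matrix_mult]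

lemma bounded_linear_trace: "bounded_linear (trace :: real^'n^'n \<Rightarrow> real)"
  unfolding linear_conv_bounded_linear[symmetric]
  by (rule linearI) (simp_all add: trace_add trace_scaleR)

lemmas has_derivative_trace [derivative_intros] = bounded_linear.has_derivative[OF bounded_linear_trace]
lemmas continuous_on_trace [continuous_intros] = bounded_linear.continuous_on[OF bounded_linear_trace]

section \<open>Continuity and derivatives of the determinant and the inverse\<close>

lemma continuous_on_det [continuous_intros]:
  fixes f :: "'a::topological_space \<Rightarrow> real^'n^'n"
  shows "continuous_on S f \<Longrightarrow> continuous_on S (\<lambda>x. det (f x))"
  unfolding det_def by (intro continuous_intros)

lemma tendsto_det [tendsto_intros]:
  fixes f :: "'a \<Rightarrow> real^'n^'n"
  shows "(f \<longlongrightarrow> A) F \<Longrightarrow> ((\<lambda>x. det (f x)) \<longlongrightarrow> det A) F"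
  unfolding det_def by (intro tendsto_intros)

text \<open>Cramer's rule, column by column of the identity. Entries that are quotients of
  determinants make the inverse continuous before anything is known about its derivative.\<close>

lemma matrix_inv_cramer:
  fixes A :: "real^'n^'n"
  assumes "det A \<noteq> 0"
  shows "matrix_inv A = (\<chi> k l. det (\<chi> i j. if j = k then mat 1 $ i $ l else A$i$j) / det A)"
proof -
  have "A *v (\<chi> k. matrix_inv A $ k $ l) = (\<chi> i. mat 1 $ i $ l)" for l
    using matrix_inv_right[OF assms]
    by (simp add: vec_eq_iff matrix_vector_mult_def matrix_matrix_mult_def)
  then have "(\<chi> k. matrix_inv A $ k $ l) = (\<chi> k. det (\<chi> i j. if j = k then mat 1 $ i $ l else A$i$j) / det A)" for l
    unfolding cramer[OF assms] vec_lambda_beta .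
  then show ?thesis by (simp add: vec_eq_iff)
qed

lemma tendsto_matrix_inv [tendsto_intros]:
  fixes f :: "'a \<Rightarrow> real^'n^'n"
  assumes f: "(f \<longlongrightarrow> A) F" and A: "det A \<noteq> 0"
  shows "((\<lambda>x. matrix_inv (f x)) \<longlongrightarrow> matrix_inv A) F"
proof -
  have ev: "\<forall>\<^sub>F x in F. det (f x) \<noteq> 0"
    using tendsto_imp_eventually_ne[OF tendsto_det[OF f] A] .
  have "((\<lambda>x. \<chi> k l. det (\<chi> i j. if j = k then mat 1 $ i $ l else f x$i$j) / det (f x)) \<longlongrightarrow> matrix_inv A) F"
    unfolding matrix_inv_cramer[OF A]
  proof (intro vec_tendstoI, unfold vec_lambda_beta, intro tendsto_divide tendsto_det f A vec_tendstoI, unfold vec_lambda_beta)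
    show "((\<lambda>x. if j = k then mat 1 $ i $ l else f x $ i $ j) \<longlongrightarrow> (if j = k then mat 1 $ i $ l else A $ i $ j)) F" for i j k l
      by (cases "j = k") (simp_all add: tendsto_vec_nth[OF tendsto_vec_nth[OF f]])
  qed
  then show ?thesis
    by (rule Lim_transform_eventually) (use ev in eventually_elim, simp add: matrix_inv_cramer)
qed

lemma has_derivative_matrix_inv:
  fixes X :: "real^'n^'n"
  assumes X: "det X \<noteq> 0"
  shows "(matrix_inv has_derivative (\<lambda>H. - (matrix_inv X ** H ** matrix_inv X))) (at X)"
proof (unfold has_derivative_iff_norm, intro conjI)
  show "bounded_linear (\<lambda>H. - (matrix_inv X ** H ** matrix_inv X))"
    unfolding linear_conv_bounded_linear[symmetric]
    by (rule linearI) (simp_all add: matrix_add_ldistrib matrix_add_rdistrib matrix_scaleR_mult matrix_mult_scaleR)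
  have inv: "(matrix_inv \<longlongrightarrow> matrix_inv X) (at X)"
    by (intro tendsto_matrix_inv tendsto_ident_at X)
  have ev: "\<forall>\<^sub>F Y in at X. det Y \<noteq> 0"
    by (rule tendsto_imp_eventually_ne[OF tendsto_det[OF tendsto_ident_at] X])
  show "((\<lambda>Y. norm (matrix_inv Y - matrix_inv X - - (matrix_inv X ** (Y - X) ** matrix_inv X)) / norm (Y - X)) \<longlongrightarrow> 0) (at X)"
  proof (rule Lim_null_comparison)
    show "\<forall>\<^sub>F Y in at X. norm (norm (matrix_inv Y - matrix_inv X - - (matrix_inv X ** (Y - X) ** matrix_inv X)) / norm (Y - X))
        \<le> norm (matrix_inv X) * norm (matrix_inv X - matrix_inv Y)"
      using ev
    proof eventually_elim
      case (elim Y)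
      \<comment> \<open>The resolvent identity: the remainder has the factor Y - X and a second
        factor X^-1 - Y^-1 that tends to 0, so continuity of the inverse already gives
        differentiability.\<close>
      have "matrix_inv Y - matrix_inv X - - (matrix_inv X ** (Y - X) ** matrix_inv X)
          = matrix_inv X ** (Y - X) ** (matrix_inv X - matrix_inv Y)"
        by (simp add: matrix_diff_ldistrib matrix_diff_rdistrib matrix_inv_left[OF X]
            matrix_mul_assoc[symmetric] matrix_inv_right[OF elim])
      also have "norm \<dots> \<le> (norm (matrix_inv X) * norm (Y - X)) * norm (matrix_inv X - matrix_inv Y)"
        by (meson norm_matrix_mult_le mult_right_mono norm_ge_zero order_trans)
      finally show ?case
        by (cases "Y = X") (simp_all add: field_simps)
    qed
    show "((\<lambda>Y. norm (matrix_inv X) * norm (matrix_inv X - matrix_inv Y)) \<longlongrightarrow> 0) (at X)"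
      by (rule tendsto_eq_intros inv | simp)+
  qed
qed

text \<open>In the differentiated Leibniz formula only the identity permutation survives: any other
  one moves at least two points, so after the removal of one factor an off-diagonal entry of the
  identity remains.\<close>

lemma has_derivative_det_mat1: "((det :: real^'n^'n \<Rightarrow> real) has_derivative trace) (at (mat 1))"
proof -
  have "((det :: real^'n^'n \<Rightarrow> real) has_derivative
     (\<lambda>H. \<Sum>p\<in>{p. p permutes UNIV}. of_int (sign p) *
        (\<Sum>i\<in>UNIV. H $ i $ p i * (\<Prod>j\<in>UNIV - {i}. mat 1 $ j $ p j)))) (at (mat 1))"
    unfolding det_def
    by (intro has_derivative_sum has_derivative_mult_right has_derivative_prod
        bounded_linear_imp_has_derivative bounded_linear_compose[OF bounded_linear_vec_nth bounded_linear_vec_nth])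
  moreover have "(\<Sum>p\<in>{p. p permutes UNIV}. of_int (sign p) *
        (\<Sum>i\<in>UNIV. H $ i $ p i * (\<Prod>j\<in>UNIV - {i}. mat 1 $ j $ p j))) = trace H" for H :: "real^'n^'n"
  proof -
    have 0: "(\<Prod>j\<in>UNIV - {i}. mat 1 $ j $ p j) = (0::real)" if p: "p permutes (UNIV::'n set)" "p \<noteq> id" for p i
    proof -
      have "\<exists>j. j \<noteq> i \<and> p j \<noteq> j"
      proof (rule ccontr)
        assume "\<not> ?thesis"
        then have *: "\<And>j. j \<noteq> i \<Longrightarrow> p j = j" by blast
        then have "p i = i" using permutes_inj[OF p(1)] by (metis injD)
        with * have "p = id" by (auto simp: fun_eq_iff) (metis)
        with p show False by simp
      qed
      then obtain j where "j \<noteq> i" "p j \<noteq> j" by blast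
      then show ?thesis by (intro prod_zero bexI[of _ j]) (auto simp: mat_def)
    qed
    have "(\<Sum>p\<in>{p. p permutes UNIV}. of_int (sign p) *
        (\<Sum>i\<in>UNIV. H $ i $ p i * (\<Prod>j\<in>UNIV - {i}. mat 1 $ j $ p j)))
      = (\<Sum>p\<in>{id}. of_int (sign p) *
        (\<Sum>i\<in>UNIV. H $ i $ p i * (\<Prod>j\<in>UNIV - {i}. mat 1 $ j $ p j)))"
      by (rule sum.mono_neutral_right) (auto simp: permutes_id 0 finite_permutations)
    also have "\<dots> = trace H" by (simp add: trace_def mat_def)
    finally show ?thesis .
  qed
  ultimately show ?thesis by simp
qed

text \<open>Jacobi's formula, transported from the identity matrix by det Y = det X * det (X^-1
  Y).\<close>

lemma has_derivative_det:
  fixes X :: "real^'n^'n"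
  assumes X: "det X \<noteq> 0"
  shows "(det has_derivative (\<lambda>H. det X * trace (matrix_inv X ** H))) (at X)"
proof -
  have "((\<lambda>Y. matrix_inv X ** Y) has_derivative (\<lambda>H. matrix_inv X ** H)) (at X)"
    by (rule bounded_linear_imp_has_derivative[OF bounded_bilinear.bounded_linear_right[OF bounded_bilinear_matrix_mult]])
  moreover have "(det has_derivative trace) (at (matrix_inv X ** X))"
    by (simp add: matrix_inv_left[OF X] has_derivative_det_mat1)
  ultimately have "((\<lambda>Y. det (matrix_inv X ** Y)) has_derivative (\<lambda>H. trace (matrix_inv X ** H))) (at X)"
    by (rule has_derivative_compose)
  then have "((\<lambda>Y. det X * det (matrix_inv X ** Y)) has_derivative (\<lambda>H. det X * trace (matrix_inv X ** H))) (at X)"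
    by (rule has_derivative_mult_right)
  moreover have "det X * det (matrix_inv X ** Y) = det Y" for Y
    by (simp add: det_mul[symmetric] matrix_mul_assoc matrix_inv_right[OF X])
  ultimately show ?thesis by simp
qed

lemma has_derivative_ln_det:
  fixes X :: "real^'n^'n"
  assumes X: "det X > 0"
  shows "((\<lambda>X. ln (det X)) has_derivative (\<lambda>H. trace (matrix_inv X ** H))) (at X)"
proof -
  have "(ln has_derivative (*) (inverse (det X))) (at (det X))"
    using DERIV_ln[OF X] by (simp add: has_field_derivative_def)
  from has_derivative_compose[OF has_derivative_det this] X show ?thesis
    by (simp add: field_simps)
qed

lemma det_scaleR_matrix: "det (c *\<^sub>R A) = c ^ CARD('n) * det (A :: real^'n^'n)"
proof -
  have "c *\<^sub>R A = (\<chi> i. c *s A $ i)"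
    by (simp add: vec_eq_iff)
  then show ?thesis
    using det_rows_mul[of "\<lambda>_. c" "\<lambda>i. A $ i"] by simp
qed

section \<open>Positive definite matrices and Schur complements\<close>

lemma inner_symmetric_matrix:
  fixes A :: "real^'n^'n"
  assumes "transpose A = A"
  shows "x \<bullet> (A *v y) = (A *v x) \<bullet> y"
  by (metis assms dot_lmul_matrix transpose_matrix_vector)

text \<open>Gram-Schmidt for the inner product x^T A y. The index set is a subset of
  \<open>'n\<close> that grows to \<open>UNIV\<close>, so the final family provides the columns of a
  square matrix. A further vector exists as long as the index set is proper, by counting
  dimensions.\<close>

lemma pos_def_gram_schmidt:
  fixes A :: "real^'n^'n" and I :: "'n set"
  assumes A: "pos_def A"
  shows "\<exists>v. \<forall>i\<in>I. \<forall>j\<in>I. v i \<bullet> (A *v v j) = (if i = j then 1 else 0)"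
  using finite[of I]
proof (induction I rule: finite_induct)
  case empty
  show ?case by simp
next
  case (insert k I)
  then obtain v where v: "\<And>i j. i \<in> I \<Longrightarrow> j \<in> I \<Longrightarrow> v i \<bullet> (A *v v j) = (if i = j then 1 else 0)"
    by blast
  have sym: "transpose A = A" using A by (simp add: pos_def_def)
  have "I \<noteq> UNIV" using insert.hyps by auto
  then have "card I < CARD('n)" by (simp add: psubset_card_mono psubset_eq)
  moreover have "dim (span (v ` I)) \<le> card I"
    using dim_le_card'[of "v ` I"] card_image_le[of I v] insert.hyps by simp
  ultimately have "span (v ` I) \<noteq> (UNIV :: (real^'n) set)"
    by (metis dim_UNIV DIM_cart DIM_real mult.right_neutral not_le)
  then obtain x where x: "x \<notin> span (v ` I)" by blast
  define y where "y = x - (\<Sum>i\<in>I. (v i \<bullet> (A *v x)) *\<^sub>R v i)"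
  have "(\<Sum>i\<in>I. (v i \<bullet> (A *v x)) *\<^sub>R v i) \<in> span (v ` I)"
    by (intro span_sum span_scale span_base) auto
  with x have "y \<noteq> 0" unfolding y_def by auto
  then have c: "y \<bullet> (A *v y) > 0" using A by (simp add: pos_def_def)
  have orth: "v i \<bullet> (A *v y) = 0" if i: "i \<in> I" for i
  proof -
    have "v i \<bullet> (A *v y) = v i \<bullet> (A *v x) - (\<Sum>j\<in>I. (v j \<bullet> (A *v x)) * (v i \<bullet> (A *v v j)))"
      by (simp add: y_def matrix_vector_mult_diff_distrib inner_diff_right
          linear_sum[OF matrix_vector_mul_linear] inner_sum_right matrix_vector_mult_scaleR)
    also have "(\<Sum>j\<in>I. (v j \<bullet> (A *v x)) * (v i \<bullet> (A *v v j))) = (\<Sum>j\<in>I. if i = j then v i \<bullet> (A *v x) else 0)"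
      using v[OF i] by (intro sum.cong) auto
    also have "v i \<bullet> (A *v x) - \<dots> = 0" using i insert.hyps by simp
    finally show ?thesis .
  qed
  define z where "z = (1 / sqrt (y \<bullet> (A *v y))) *\<^sub>R y"
  have z1: "z \<bullet> (A *v z) = 1"
    using c by (simp add: z_def matrix_vector_mult_scaleR)
  have z2: "v i \<bullet> (A *v z) = 0" if "i \<in> I" for i
    using orth[OF that] by (simp add: z_def matrix_vector_mult_scaleR)
  have z3: "z \<bullet> (A *v v i) = 0" if "i \<in> I" for i
    using z2[OF that] inner_symmetric_matrix[OF sym] by (metis inner_commute)
  show ?case
    by (rule exI[of _ "v(k := z)"]) (use insert.hyps v z1 z2 z3 in auto)
qed

text \<open>P takes the role of A^(-1/2) without recourse to eigenvalues.\<close>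

lemma pos_def_congruent_mat1:
  fixes A :: "real^'n^'n"
  assumes "pos_def A"
  obtains P :: "real^'n^'n" where "transpose P ** A ** P = mat 1"
proof -
  obtain v :: "'n \<Rightarrow> real^'n" where v: "\<forall>i j. v i \<bullet> (A *v v j) = (if i = j then 1 else 0)"
    using pos_def_gram_schmidt[OF assms, of UNIV] by auto
  have "transpose (\<chi> r i. v i $ r) ** A ** (\<chi> r i. v i $ r) = mat 1"
    unfolding matrix_mul_assoc[symmetric] using v
    by (simp add: vec_eq_iff matrix_matrix_mult_def matrix_vector_mult_def transpose_def inner_vec_def mat_def)
  then show ?thesis by (rule that)
qed

text \<open>Having A^-1 in the form P P^T turns traces that contain A^-1 into Frobenius
  norms.\<close>

lemma matrix_inv_congruent_mat1:
  fixes A P :: "real^'n^'n"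
  assumes "transpose P ** A ** P = mat 1"
  shows "matrix_inv A = P ** transpose P"
proof (rule matrix_inv_eqI)
  have "P ** (transpose P ** A) = mat 1" using assms matrix_left_right_inverse by blast
  then have "(P ** transpose P) ** A = mat 1" by (simp add: matrix_mul_assoc)
  then show "A ** (P ** transpose P) = mat 1" using matrix_left_right_inverse by blast
qed

lemma pos_def_det_pos:
  fixes A :: "real^'n^'n"
  assumes "pos_def A"
  shows "det A > 0"
proof -
  obtain P :: "real^'n^'n" where "transpose P ** A ** P = mat 1"
    using pos_def_congruent_mat1[OF assms] .
  then have "det (transpose P ** A ** P) = 1" by simp
  then have "(det P)\<^sup>2 * det A = 1" by (simp add: det_mul power2_eq_square mult_ac)
  then show ?thesis by (metis zero_less_mult_pos zero_less_one zero_le_power2 mult_zero_left order_le_less)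
qed

lemma pos_def_add: "pos_def A \<Longrightarrow> pos_def B \<Longrightarrow> pos_def (A + B)"
  unfolding pos_def_def transpose_add matrix_vector_mult_add_rdistrib inner_add_right
  by (auto intro: add_pos_pos)

lemma pos_def_scaleR: "pos_def A \<Longrightarrow> c > 0 \<Longrightarrow> pos_def (c *\<^sub>R A)"
  by (simp add: pos_def_def transpose_scalar scaleR_matrix_vector_assoc[symmetric])

lemma transpose_matrix_inv:
  fixes A :: "real^'n^'n"
  assumes "det A \<noteq> 0"
  shows "transpose (matrix_inv A) = matrix_inv (transpose A)"
  by (rule matrix_inv_eqI[symmetric])
    (simp add: matrix_transpose_mul[symmetric] matrix_inv_left assms)

lemma pos_def_matrix_inv:
  fixes A :: "real^'n^'n"
  assumes A: "pos_def A"
  shows "pos_def (matrix_inv A)"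
proof -
  have d: "det A \<noteq> 0" using pos_def_det_pos[OF A] by simp
  have "x \<bullet> (matrix_inv A *v x) > 0" if "x \<noteq> 0" for x
  proof -
    define y where "y = matrix_inv A *v x"
    have x: "x = A *v y" by (simp add: y_def matrix_vector_mul_assoc matrix_inv_right[OF d])
    with that have "y \<noteq> 0" by auto
    then show ?thesis
      unfolding y_def[symmetric] using A by (subst x) (simp add: pos_def_def inner_commute)
  qed
  then show ?thesis
    using A d by (simp add: pos_def_def transpose_matrix_inv)
qed

section \<open>Schur complements in terms of A + B and A - B\<close>

lemma schur_factorization:
  fixes A B :: "real^'n^'n"
  assumes "det A \<noteq> 0"
  shows "A - B ** matrix_inv A ** B = (A - B) ** matrix_inv A ** (A + B)"
    and "A - B ** matrix_inv A ** B = (A + B) ** matrix_inv A ** (A - B)"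
  using assms
  by (simp_all add: matrix_diff_ldistrib matrix_diff_rdistrib matrix_add_ldistrib matrix_add_rdistrib
      matrix_inv_right matrix_inv_left matrix_mul_assoc)
     (simp_all add: matrix_mul_assoc[symmetric] matrix_inv_left)

lemma matrix_inv_schur:
  fixes A B :: "real^'n^'n"
  assumes "det A \<noteq> 0" "det (A + B) \<noteq> 0" "det (A - B) \<noteq> 0"
  shows "matrix_inv (A - B ** matrix_inv A ** B) = matrix_inv (A + B) ** A ** matrix_inv (A - B)"
proof (rule matrix_inv_eqI)
  have "(A - B) ** matrix_inv A ** (A + B) ** (matrix_inv (A + B) ** A ** matrix_inv (A - B))
    = (A - B) ** (matrix_inv A ** ((A + B) ** matrix_inv (A + B)) ** A) ** matrix_inv (A - B)"
    by (simp only: matrix_mul_assoc)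
  then show "(A - B ** matrix_inv A ** B) ** (matrix_inv (A + B) ** A ** matrix_inv (A - B)) = mat 1"
    by (simp add: schur_factorization(1) assms matrix_inv_right matrix_inv_left)
qed

text \<open>A is the mean of A + B and A - B, and each summand cancels one of the outer factors of
  \<open>matrix_inv_schur\<close>. In this form positive definiteness of the inverse is
  visible.\<close>

lemma matrix_inv_schur_average:
  fixes A B :: "real^'n^'n"
  assumes "det A \<noteq> 0" "det (A + B) \<noteq> 0" "det (A - B) \<noteq> 0"
  shows "matrix_inv (A - B ** matrix_inv A ** B) = (1/2) *\<^sub>R (matrix_inv (A + B) + matrix_inv (A - B))"
proof -
  have "A = (1/2) *\<^sub>R ((A + B) + (A - B))"
    by (simp add: scaleR_2[symmetric])
  then have "matrix_inv (A + B) ** A ** matrix_inv (A - B)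
    = matrix_inv (A + B) ** ((1/2) *\<^sub>R ((A + B) + (A - B))) ** matrix_inv (A - B)"
    by simp
  also have "\<dots> = (1/2) *\<^sub>R (matrix_inv (A + B) ** (A + B) ** matrix_inv (A - B)
     + matrix_inv (A + B) ** ((A - B) ** matrix_inv (A - B)))"
    by (simp only: matrix_mult_scaleR matrix_scaleR_mult matrix_add_ldistrib[of _ "A + B"] matrix_add_rdistrib[of "_ ** (A+B)"] matrix_mul_assoc)
  also have "\<dots> = (1/2) *\<^sub>R (matrix_inv (A + B) + matrix_inv (A - B))"
    by (simp add: assms matrix_inv_right matrix_inv_left add.commute)
  finally show ?thesis using matrix_inv_schur[OF assms] by simp
qed

text \<open>Each component brings one factor det A into a denominator; this is where the positive
  multiple of log det A in the barrier originates.\<close>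

lemma det_schur:
  fixes A B :: "real^'n^'n"
  assumes "det A \<noteq> 0"
  shows "det (A - B ** matrix_inv A ** B) = det (A + B) * det (A - B) / det A"
proof -
  have "det (matrix_inv A) * det A = 1"
    by (simp add: det_mul[symmetric] matrix_inv_left assms)
  then show ?thesis
    using assms by (simp add: schur_factorization(1) det_mul field_simps)
qed

lemma pos_def_schur_iff:
  fixes A B :: "real^'n^'n"
  assumes B: "transpose B = B"
  shows "pos_def A \<and> pos_def (A - B ** matrix_inv A ** B) \<longleftrightarrow> pos_def (A + B) \<and> pos_def (A - B)"
proof (intro iffI; elim conjE)
  assume p: "pos_def (A + B)" "pos_def (A - B)"
  have "(1/2) *\<^sub>R ((A + B) + (A - B)) = A" by (simp add: scaleR_2[symmetric])
  with pos_def_scaleR[OF pos_def_add[OF p], of "1/2"] have A: "pos_def A" by simp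
  note nz = A[THEN pos_def_det_pos] p[THEN pos_def_det_pos]
  let ?S = "A - B ** matrix_inv A ** B"
  \<comment> \<open>The inverse of the Schur complement is an average of positive definite matrices;
    inverting once more returns to the complement itself.\<close>
  have S: "pos_def (matrix_inv ?S)"
    using nz p by (simp add: matrix_inv_schur_average pos_def_scaleR pos_def_add pos_def_matrix_inv)
  have "det ?S \<noteq> 0" using nz by (simp add: det_schur)
  then have "matrix_inv (matrix_inv ?S) = ?S"
    by (intro matrix_inv_eqI matrix_inv_left)
  with pos_def_matrix_inv[OF S] A show "pos_def A \<and> pos_def ?S" by simp
next
  assume A: "pos_def A" and S: "pos_def (A - B ** matrix_inv A ** B)"
  have dA: "det A \<noteq> 0" using pos_def_det_pos[OF A] by simp
  obtain P :: "real^'n^'n" where P: "transpose P ** A ** P = mat 1"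
    using pos_def_congruent_mat1[OF A] .
  have iA: "matrix_inv A = P ** transpose P" by (rule matrix_inv_congruent_mat1[OF P])
  have symA: "transpose A = A" using A by (simp add: pos_def_def)
  \<comment> \<open>In the inner product given by A, positivity of the Schur complement says that the
      self-adjoint operator A^-1 B is a strict contraction.\<close>
  have lt: "\<bar>x \<bullet> (B *v x)\<bar> < x \<bullet> (A *v x)" if x: "x \<noteq> 0" for x
  proof -
    \<comment> \<open>With these vectors x^T A x = |z|^2, x^T B x = w . z and x^T B A^-1 B x =
      |w|^2. Positivity of the complement thus reads |w| < |z|, and Cauchy-Schwarz finishes.\<close>
    define z where "z = transpose P *v (A *v x)"
    define w where "w = transpose P *v (B *v x)"
    have zz: "u \<bullet> (P *v (transpose P *v v)) = (transpose P *v u) \<bullet> (transpose P *v v)" for u v :: "real^'n"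
      by (simp add: dot_lmul_matrix)
    have PA: "P *v (transpose P *v (A *v x)) = x"
      by (simp add: matrix_vector_mul_assoc matrix_mul_assoc iA[symmetric] matrix_inv_left dA del: transpose_matrix_vector)
    have Ax: "x \<bullet> (A *v x) = (norm z)\<^sup>2"
      using zz[of "A *v x" "A *v x"] by (simp only: z_def[symmetric] power2_norm_eq_inner) (metis PA z_def inner_commute)
    have Bx: "x \<bullet> (B *v x) = w \<bullet> z"
      using zz[of "B *v x" "A *v x"] by (simp only: PA w_def z_def inner_commute[of x])
    have "0 < x \<bullet> ((A - B ** matrix_inv A ** B) *v x)" using S x by (simp add: pos_def_def)
    also have "\<dots> = x \<bullet> (A *v x) - x \<bullet> (B *v (P *v (transpose P *v (B *v x))))"
      by (simp add: iA matrix_vector_mult_diff_rdistrib inner_diff_right matrix_vector_mul_assoc matrix_mul_assoc del: transpose_matrix_vector)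
    also have "x \<bullet> (B *v (P *v (transpose P *v (B *v x)))) = (norm w)\<^sup>2"
      unfolding inner_symmetric_matrix[OF B] zz by (simp only: w_def power2_norm_eq_inner)
    finally have "(norm w)\<^sup>2 < (norm z)\<^sup>2" by (simp add: Ax)
    then have wz: "norm w < norm z" by (simp add: power2_less_imp_less)
    have "\<bar>w \<bullet> z\<bar> \<le> norm w * norm z" by (rule Cauchy_Schwarz_ineq2)
    also have "\<dots> < norm z * norm z"
      using wz by (intro mult_strict_right_mono) (auto intro: le_less_trans[OF norm_ge_zero])
    finally show ?thesis by (simp add: Ax Bx power2_eq_square)
  qed
  have "x \<bullet> (A *v x) + x \<bullet> (B *v x) > 0" "x \<bullet> (A *v x) - x \<bullet> (B *v x) > 0" if "x \<noteq> 0" for x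
    using lt[OF that] by linarith+
  then show "pos_def (A + B) \<and> pos_def (A - B)"
    by (simp add: pos_def_def transpose_add transpose_diff symA B matrix_vector_mult_add_rdistrib
        matrix_vector_mult_diff_rdistrib inner_add_right inner_diff_right)
qed

text \<open>From S = P P^T follows norm S <= (norm P)^2 = trace S. To have S itself in this form,
  the congruence is taken for its inverse.\<close>

lemma pos_def_norm_le_trace:
  fixes S :: "real^'n^'n"
  assumes S: "pos_def S"
  shows "norm S \<le> trace S"
proof -
  obtain P :: "real^'n^'n" where P: "transpose P ** matrix_inv S ** P = mat 1"
    using pos_def_congruent_mat1[OF pos_def_matrix_inv[OF S]] .
  have "matrix_inv (matrix_inv S) = S"
    using pos_def_det_pos[OF S] by (intro matrix_inv_eqI matrix_inv_left) simp
  then have SP: "S = P ** transpose P"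
    using matrix_inv_congruent_mat1[OF P] by simp
  then show ?thesis
    using norm_matrix_mult_le[of P "transpose P"] norm_matrix_sq_trace[of P]
    by (simp add: norm_transpose power2_eq_square)
qed

text \<open>The subtracted matrix is (B P) (B P)^T, whose trace is a squared norm.\<close>

lemma trace_schur_le:
  fixes A B :: "real^'n^'n"
  assumes A: "pos_def A" and B: "transpose B = B"
  shows "trace (A - B ** matrix_inv A ** B) \<le> trace A"
proof -
  obtain P :: "real^'n^'n" where P: "transpose P ** A ** P = mat 1"
    using pos_def_congruent_mat1[OF A] .
  have "trace (B ** matrix_inv A ** B) = (norm (B ** P))\<^sup>2"
    by (simp add: norm_matrix_sq_trace matrix_inv_congruent_mat1[OF P] matrix_transpose_mul B matrix_mul_assoc)
  then show ?thesis by (simp add: trace_sub)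
qed

section \<open>Limits, convexity and openness of positive definiteness\<close>

lemma quadratic_form_continuous:
  fixes f :: "'a::topological_space \<Rightarrow> real^'n^'n" and g :: "'a \<Rightarrow> real^'n"
  assumes "continuous_on S f" "continuous_on S g"
  shows "continuous_on S (\<lambda>x. g x \<bullet> (f x *v g x))"
  unfolding inner_vec_def matrix_vector_mult_def
  by (auto intro!: continuous_intros assms simp: vec_lambda_beta)

lemma bounded_linear_transpose: "bounded_linear (transpose :: real^'n^'m \<Rightarrow> real^'m^'n)"
  unfolding linear_conv_bounded_linear[symmetric]
  by (rule linearI) (simp_all add: transpose_add transpose_scalar)

text \<open>The limit is positive semidefinite, and a nonsingular semidefinite matrix has no
  isotropic vector. At a boundary point of the domain this forces some determinant to
  vanish.\<close>

lemma pos_def_limit: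
  fixes M :: "nat \<Rightarrow> real^'n^'n"
  assumes lim: "M \<longlonglongrightarrow> N" and M: "\<And>k. pos_def (M k)" and N: "det N \<noteq> 0"
  shows "pos_def N"
proof -
  have "transpose (M k) = M k" for k using M by (simp add: pos_def_def)
  then have "M \<longlonglongrightarrow> transpose N"
    using bounded_linear.tendsto[OF bounded_linear_transpose lim] by simp
  then have sym: "transpose N = N"
    using lim by (rule LIMSEQ_unique)
  have psd: "x \<bullet> (N *v x) \<ge> 0" for x
  proof (rule LIMSEQ_le_const)
    have "continuous_on UNIV (\<lambda>A::real^'n^'n. x \<bullet> (A *v x))"
      by (intro quadratic_form_continuous continuous_intros)
    then show "(\<lambda>k. x \<bullet> (M k *v x)) \<longlonglongrightarrow> x \<bullet> (N *v x)"
      using lim continuous_on_tendsto_compose[of UNIV _ M N] by simp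
    show "\<exists>n. \<forall>k\<ge>n. 0 \<le> x \<bullet> (M k *v x)"
      using M by (metis pos_def_def inner_zero_left less_imp_le order_refl)
  qed
  have "x \<bullet> (N *v x) \<noteq> 0" if "x \<noteq> 0" for x
  proof
    assume 0: "x \<bullet> (N *v x) = 0"
    define z where "z = N *v x"
    have "x = matrix_inv N *v z" by (simp add: z_def matrix_vector_mul_assoc matrix_inv_left N)
    with that have z: "z \<bullet> z > 0" by auto
    define q where "q = z \<bullet> (N *v z)"
    have q: "q \<ge> 0" using psd by (simp add: q_def)
    \<comment> \<open>At x - r z the form equals r (r q - 2 |z|^2), which is negative for small r >
      0. This r makes r q <= |z|^2, and the 1 in the denominator covers q = 0.\<close>
    define r where "r = (z \<bullet> z) / (q + 1)"
    have "0 \<le> (x - r *\<^sub>R z) \<bullet> (N *v (x - r *\<^sub>R z))" by (rule psd)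
    also have "\<dots> = r * (r * q - 2 * (z \<bullet> z))"
      using 0 inner_symmetric_matrix[OF sym, of x z]
      by (simp add: matrix_vector_mult_diff_distrib matrix_vector_mult_scaleR inner_diff_left inner_diff_right
          z_def[symmetric] q_def[symmetric] inner_commute algebra_simps)
    finally have *: "0 \<le> r * (r * q - 2 * (z \<bullet> z))" .
    have "r > 0" using z q by (simp add: r_def)
    moreover have "r * q \<le> z \<bullet> z" using z q by (simp add: r_def field_simps)
    ultimately have "r * (r * q - 2 * (z \<bullet> z)) < 0" using z by (intro mult_pos_neg) linarith+
    with * show False by simp
  qed
  with psd sym show ?thesis by (simp add: pos_def_def order_less_le)
qed

lemma convex_pos_def: "convex {A :: real^'n^'n. pos_def A}"
proof (rule convexI)
  fix A B :: "real^'n^'n" and u v :: real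
  assume "A \<in> {A. pos_def A}" "B \<in> {A. pos_def A}" "0 \<le> u" "0 \<le> v" "u + v = 1"
  then show "u *\<^sub>R A + v *\<^sub>R B \<in> {A. pos_def A}"
    \<comment> \<open>A zero multiple is not positive definite, so the two endpoints of the segment
      are treated apart.\<close>
    by (cases "u = 0 \<or> v = 0") (auto simp: pos_def_add pos_def_scaleR)
qed

text \<open>The complement is the projection of a closed set of pairs (x, s) along the unit sphere,
  and projections along compact sets preserve closedness. Symmetry must hold for every s because it
  is not an open condition.\<close>

lemma open_pos_def_linear:
  fixes \<phi> :: "'a::euclidean_space \<Rightarrow> real^'n^'n"
  assumes l: "linear \<phi>" and sym: "\<And>s. transpose (\<phi> s) = \<phi> s"
  shows "open {s. pos_def (\<phi> s)}"
proof -
  let ?T = "{z :: (real^'n) \<times> 'a. fst z \<bullet> (\<phi> (snd z) *v fst z) \<le> 0}"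
  have "continuous_on UNIV \<phi>" using l by (simp add: linear_continuous_on linear_conv_bounded_linear)
  then have "continuous_on UNIV (\<lambda>z :: (real^'n) \<times> 'a. \<phi> (snd z))"
    by (rule continuous_on_compose2) (auto intro: continuous_intros)
  then have "closed ?T"
    by (intro closed_Collect_le quadratic_form_continuous continuous_intros)
  then have "closed {s. \<exists>x. x \<in> sphere 0 1 \<and> (x, s) \<in> ?T}"
    by (intro closed_compact_projection) auto
  moreover have "pos_def (\<phi> s) \<longleftrightarrow> \<not> (\<exists>x. x \<in> sphere 0 1 \<and> (x, s) \<in> ?T)" for s
  proof
    assume "pos_def (\<phi> s)"
    then show "\<not> (\<exists>x. x \<in> sphere 0 1 \<and> (x, s) \<in> ?T)"
      by (auto simp: pos_def_def) (metis norm_zero not_le zero_neq_one)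
  next
    assume *: "\<not> (\<exists>x. x \<in> sphere 0 1 \<and> (x, s) \<in> ?T)"
    have "x \<bullet> (\<phi> s *v x) > 0" if "x \<noteq> 0" for x
    proof -
      define y where "y = (1 / norm x) *\<^sub>R x"
      have x: "x = norm x *\<^sub>R y" and "norm y = 1" using that by (simp_all add: y_def)
      then have "y \<bullet> (\<phi> s *v y) > 0" using * by (auto simp: not_le)
      then show ?thesis using that
        by (subst x, subst x) (simp add: matrix_vector_mult_scaleR)
    qed
    then show "pos_def (\<phi> s)" by (simp add: pos_def_def sym)
  qed
  then have "{s. pos_def (\<phi> s)} = - {s. \<exists>x. x \<in> sphere 0 1 \<and> (x, s) \<in> ?T}" by blast
  ultimately show ?thesis by (simp only: open_Compl)
qed

section \<open>Block decomposition of a direction\<close>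

lemma sum_UNIV_Plus:
  "(\<Sum>i\<in>(UNIV :: ('a::finite + 'b::finite) set). f i) = (\<Sum>i\<in>UNIV. f (Inl i)) + (\<Sum>i\<in>UNIV. f (Inr i) :: real)"
  using sum.Plus[of "UNIV :: 'a set" "UNIV :: 'b set" f] by (simp add: comp_def)

definition block_mat :: "real^'a^'a \<Rightarrow> real^'b^'a \<Rightarrow> real^'a^'b \<Rightarrow> real^'b^'b \<Rightarrow> real^('a + 'b)^('a + 'b)" where
  "block_mat A B C D = (\<chi> i j. case i of
      Inl i' \<Rightarrow> (case j of Inl j' \<Rightarrow> A $ i' $ j' | Inr j' \<Rightarrow> B $ i' $ j')
    | Inr i' \<Rightarrow> (case j of Inl j' \<Rightarrow> C $ i' $ j' | Inr j' \<Rightarrow> D $ i' $ j'))"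

lemma block_mat_mult:
  "block_mat A B C D ** block_mat A' B' C' D'
   = block_mat (A ** A' + B ** C') (A ** B' + B ** D') (C ** A' + D ** C') (C ** B' + D ** D')"
  by (simp add: vec_eq_iff block_mat_def matrix_matrix_mult_def sum_UNIV_Plus split: sum.splits)

lemma trace_block_mat: "trace (block_mat A B C D) = trace A + trace D"
  by (simp add: trace_def block_mat_def sum_UNIV_Plus)

lemma symmetric_block_mat_cases:
  fixes H :: "real^('a::finite + 'b::finite)^('a + 'b)"
  assumes "transpose H = H"
  obtains A C D where "H = block_mat A C (transpose C) D" "transpose A = A" "transpose D = D"
    "A = (\<chi> i j. H $ Inl i $ Inl j)"
proof
  have H: "H $ i $ j = H $ j $ i" for i j
    using arg_cong[OF assms, of "\<lambda>M. M $ j $ i"] by (simp add: transpose_def)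
  let ?A = "\<chi> i j. H $ Inl i $ Inl j" and ?C = "\<chi> i j. H $ Inl i $ Inr j" and ?D = "\<chi> i j. H $ Inr i $ Inr j"
  show "H = block_mat ?A ?C (transpose ?C) ?D"
    by (simp add: vec_eq_iff block_mat_def transpose_def H split: sum.splits)
  show "transpose ?A = ?A" "transpose ?D = ?D"
    by (simp_all add: vec_eq_iff transpose_def H)
qed simp

text \<open>With blocks A, C, C^T, D the witnesses are \<sigma> = norm D and w = 2 (norm C)^2. The
  trace of the cube is tr A^3 + 3 tr (A C C^T) + 3 tr (D C^T C) + tr D^3; the factor 3/2 is the 3 of
  the mixed terms rewritten for w.\<close>

lemma symmetric_block_trace_bound:
  fixes H :: "real^('a::finite + 'b::finite)^('a + 'b)"
  defines "A \<equiv> (\<chi> i j. H $ Inl i $ Inl j)"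
  assumes H: "transpose H = H"
  shows "\<exists>\<sigma> w. 0 \<le> \<sigma> \<and> 0 \<le> w \<and> trace (H ** H) = (norm A)\<^sup>2 + \<sigma>\<^sup>2 + w
    \<and> \<bar>trace (H ** H ** H) - trace (A ** A ** A)\<bar> \<le> \<sigma> ^ 3 + 3 / 2 * (\<sigma> + norm A) * w"
proof -
  obtain A' C D where HB': "H = block_mat A' C (transpose C) D" "transpose A' = A'" "transpose D = D" "A' = A"
    using symmetric_block_mat_cases[OF H, folded A_def] .
  then have HB: "H = block_mat A C (transpose C) D" and A: "transpose A = A" and D: "transpose D = D"
    by simp_all
  have C2: "trace (C ** transpose C) = (norm C)\<^sup>2" "trace (transpose C ** C) = (norm C)\<^sup>2"
    using norm_matrix_sq_trace[of C] by (simp_all add: trace_mul_sym[of "transpose C"])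
  have 2: "trace (H ** H) = (norm A)\<^sup>2 + (norm D)\<^sup>2 + 2 * (norm C)\<^sup>2"
    using norm_matrix_sq_trace[of A] norm_matrix_sq_trace[of D]
    by (simp add: HB block_mat_mult trace_block_mat trace_add C2 A D)
  have "trace (H ** H ** H) = trace (A ** A ** A) + trace (C ** transpose C ** A) + trace (A ** C ** transpose C)
     + trace (C ** D ** transpose C) + trace (transpose C ** A ** C) + trace (D ** transpose C ** C)
     + trace (transpose C ** C ** D) + trace (D ** D ** D)"
    by (simp add: HB block_mat_mult trace_block_mat trace_add matrix_add_rdistrib)
  \<comment> \<open>By cyclicity the three words with one A agree, and so do the three words with
    one D.\<close>
  also have "\<dots> = trace (A ** A ** A) + 3 * trace (A ** (C ** transpose C)) + 3 * trace (D ** (transpose C ** C)) + trace (D ** D ** D)"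
    using trace_mul_sym[of "C ** transpose C" A] trace_mul_sym[of "transpose C" "A ** C"]
      trace_mul_sym[of C "D ** transpose C"] trace_mul_sym[of "transpose C ** C" D]
    by (simp add: matrix_mul_assoc)
  finally have 3: "trace (H ** H ** H) - trace (A ** A ** A)
    = 3 * trace (A ** (C ** transpose C)) + 3 * trace (D ** (transpose C ** C)) + trace (D ** (D ** D))"
    by (simp add: matrix_mul_assoc)
  have CC: "norm (C ** transpose C) \<le> (norm C)\<^sup>2" "norm (transpose C ** C) \<le> (norm C)\<^sup>2"
    using norm_matrix_mult_le[of C "transpose C"] norm_matrix_mult_le[of "transpose C" C]
    by (simp_all add: norm_transpose power2_eq_square)
  have "\<bar>trace (A ** (C ** transpose C))\<bar> \<le> norm A * (norm C)\<^sup>2"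
    by (rule order_trans[OF abs_trace_mult_le]) (simp add: CC mult_left_mono)
  moreover have "\<bar>trace (D ** (transpose C ** C))\<bar> \<le> norm D * (norm C)\<^sup>2"
    by (rule order_trans[OF abs_trace_mult_le]) (simp add: CC mult_left_mono)
  moreover have "\<bar>trace (D ** (D ** D))\<bar> \<le> norm D * (norm D * norm D)"
    by (rule order_trans[OF abs_trace_mult_le]) (simp add: norm_matrix_mult_le mult_left_mono)
  moreover have "norm D ^ 3 + 3 / 2 * (norm D + norm A) * (2 * (norm C)\<^sup>2)
      = norm D * (norm D * norm D) + 3 * (norm D * (norm C)\<^sup>2) + 3 * (norm A * (norm C)\<^sup>2)"
    by (simp add: power3_eq_cube algebra_simps)
  ultimately have "\<bar>trace (H ** H ** H) - trace (A ** A ** A)\<bar> \<le> norm D ^ 3 + 3 / 2 * (norm D + norm A) * (2 * (norm C)\<^sup>2)"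
    unfolding 3 by linarith
  with 2 show ?thesis
    by (intro exI[of _ "norm D"] exI[of _ "2 * (norm C)\<^sup>2"]) auto
qed

lemma trace_congruence: "trace (G ** M ** transpose G) = trace (transpose G ** G ** (M :: real^'n^'n))"
  using trace_mul_sym[of "G ** M" "transpose G"] by (simp add: matrix_mul_assoc)

text \<open>The matrix (G K) of the proof is a square root of diag(A + B, A - B)^-1, obtained from the
  block factorisation of ((A, B), (B, A)) into A and its Schur complement. It turns the direction
  (a + b, a - b) into a symmetric matrix with leading block \<alpha>.\<close>
lemma logdet_pair_trace_bound:
  fixes A B a b P :: "real^'n^'n"
  defines "X \<equiv> A + B" and "Y \<equiv> A - B" and "x \<equiv> a + b" and "y \<equiv> a - b"
  assumes sym: "transpose A = A" "transpose B = B" "transpose a = a" "transpose b = b"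
    and X: "pos_def X" and Y: "pos_def Y"
    and P: "transpose P ** A ** P = mat 1"
  defines "iX \<equiv> matrix_inv X" and "iY \<equiv> matrix_inv Y" and "\<alpha> \<equiv> transpose P ** a ** P"
  shows "\<exists>\<sigma> w. 0 \<le> \<sigma> \<and> 0 \<le> w \<and> trace (iX ** x ** iX ** x) + trace (iY ** y ** iY ** y) = (norm \<alpha>)\<^sup>2 + \<sigma>\<^sup>2 + w
    \<and> \<bar>trace (iX ** x ** iX ** x ** iX ** x) + trace (iY ** y ** iY ** y ** iY ** y) - trace (\<alpha> ** \<alpha> ** \<alpha>)\<bar>
      \<le> \<sigma> ^ 3 + 3 / 2 * (\<sigma> + norm \<alpha>) * w"
proof -
  define S where "S = A - B ** matrix_inv A ** B"
  define iA where "iA = matrix_inv A"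
  have posA: "pos_def A" and posS: "pos_def S"
    using pos_def_schur_iff[OF sym(2), of A] X Y by (auto simp: X_def Y_def S_def)
  have dA: "det A \<noteq> 0" and dX: "det X \<noteq> 0" and dY: "det Y \<noteq> 0" and dS: "det S \<noteq> 0"
    using posA posS X Y pos_def_det_pos by (metis less_irrefl)+
  have Xs: "transpose X = X" and Ys: "transpose Y = Y" and xs: "transpose x = x" and ys: "transpose y = y"
    by (simp_all add: X_def Y_def x_def y_def transpose_add transpose_diff sym)
  have iAs: "transpose iA = iA" by (simp add: iA_def transpose_matrix_inv dA sym)
  have iAP: "iA = P ** transpose P" unfolding iA_def by (rule matrix_inv_congruent_mat1[OF P])
  obtain Q :: "real^'n^'n" where Q: "transpose Q ** S ** Q = mat 1"
    using pos_def_congruent_mat1[OF posS] .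
  have iS: "Q ** transpose Q = iX ** A ** iY"
    using matrix_inv_congruent_mat1[OF Q] matrix_inv_schur[OF dA dX[unfolded X_def] dY[unfolded Y_def]]
    by (simp add: S_def X_def Y_def iX_def iY_def)
  have "transpose (Q ** transpose Q) = Q ** transpose Q" by (simp add: matrix_transpose_mul)
  \<comment> \<open>S^-1 is symmetric, so transposition reverses the factors. Both orders are
    needed: in G^T G the middle product must begin with Y^-1, in K^T K with X^-1.\<close>
  then have iS': "Q ** transpose Q = iY ** A ** iX"
    unfolding iS
    by (simp add: matrix_transpose_mul iX_def iY_def transpose_matrix_inv dX dY Xs Ys sym matrix_mul_assoc)
  define c where "c = 1 / sqrt 2"
  have cc: "c * c = 1/2" by (simp add: c_def)
  \<comment> \<open>Block elimination in ((A, B), (B, A)), normalised by P and Q, has the rows (P^T,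
    0) and (-Q^T B A^-1, Q^T). Multiplying on the right by the orthogonal matrix c ((1, 1), (1, -1))
    gives the columns \<open>G\<close> and \<open>K\<close>, since Q^T - Q^T B A^-1 = Q^T Y A^-1 and
    -Q^T B A^-1 - Q^T = -Q^T X A^-1.\<close>
  define G2 where "G2 = transpose Q ** Y ** iA"
  define K2 where "K2 = - (transpose Q ** X ** iA)"
  define G :: "real^'n^('n+'n)" where "G = (\<chi> i. case i of Inl j \<Rightarrow> c *\<^sub>R transpose P $ j | Inr j \<Rightarrow> c *\<^sub>R G2 $ j)"
  define K :: "real^'n^('n+'n)" where "K = (\<chi> i. case i of Inl j \<Rightarrow> c *\<^sub>R transpose P $ j | Inr j \<Rightarrow> c *\<^sub>R K2 $ j)"
  have dot: "transpose (\<chi> i. case i of Inl j \<Rightarrow> c *\<^sub>R U $ j | Inr j \<Rightarrow> c *\<^sub>R V $ j) **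
      (\<chi> i. case i of Inl j \<Rightarrow> c *\<^sub>R U' $ j | Inr j \<Rightarrow> c *\<^sub>R V' $ j)
      = (1/2) *\<^sub>R (transpose U ** U' + transpose V ** V')" for U V U' V' :: "real^'n^'n"
  proof -
    have *: "c * u * (c * v) = u * v / 2" for u v
      using cc by (metis mult.assoc mult.left_commute mult.right_neutral times_divide_eq_right)
    show ?thesis
      by (simp add: vec_eq_iff matrix_matrix_mult_def transpose_def sum_UNIV_Plus * sum_divide_distrib add_divide_distrib)
  qed
  have iXX: "iX ** X = mat 1" and XiX: "X ** iX = mat 1" and iYY: "iY ** Y = mat 1" and YiY: "Y ** iY = mat 1"
    and iAA: "iA ** A = mat 1" and AiA: "A ** iA = mat 1"
    using dX dY dA by (simp_all add: iX_def iY_def iA_def matrix_inv_left matrix_inv_right)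
  have XY: "X + Y = 2 *\<^sub>R A" by (simp add: X_def Y_def scaleR_2)
  have G2s: "transpose G2 = iA ** Y ** Q" and K2s: "transpose K2 = - (iA ** X ** Q)"
    by (simp_all add: G2_def K2_def matrix_transpose_mul transpose_minus Xs Ys iAs matrix_mul_assoc)
  have GG: "transpose G ** G = iX"
  proof -
    have "transpose G2 ** G2 = iA ** Y ** (Q ** transpose Q) ** Y ** iA"
      unfolding G2s by (simp add: G2_def matrix_mul_assoc)
    also have "\<dots> = iA ** (Y ** iY) ** A ** iX ** Y ** iA"
      by (simp add: iS' matrix_mul_assoc)
    also have "\<dots> = iX ** Y ** iA" by (simp add: YiY iAA)
    finally have "P ** transpose P + transpose G2 ** G2 = iX ** X ** iA + iX ** Y ** iA"
      by (simp add: iAP[symmetric] iXX)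
    also have "\<dots> = iX ** (X + Y) ** iA" by (simp add: matrix_add_ldistrib matrix_add_rdistrib)
    also have "\<dots> = 2 *\<^sub>R (iX ** (A ** iA))" by (simp add: XY matrix_mult_scaleR matrix_scaleR_mult matrix_mul_assoc)
    finally show ?thesis by (simp add: G_def dot AiA)
  qed
  have KK: "transpose K ** K = iY"
  proof -
    have "transpose K2 ** K2 = iA ** X ** (Q ** transpose Q) ** X ** iA"
      unfolding K2s by (simp add: K2_def matrix_mul_assoc matrix_minus_mult matrix_mult_minus)
    also have "\<dots> = iA ** (X ** iX) ** A ** iY ** X ** iA"
      by (simp add: iS matrix_mul_assoc)
    also have "\<dots> = iY ** X ** iA" by (simp add: XiX iAA)
    finally have "P ** transpose P + transpose K2 ** K2 = iY ** Y ** iA + iY ** X ** iA"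
      by (simp add: iAP[symmetric] iYY)
    also have "\<dots> = iY ** (X + Y) ** iA" by (simp add: matrix_add_ldistrib matrix_add_rdistrib add.commute)
    also have "\<dots> = 2 *\<^sub>R (iY ** (A ** iA))" by (simp add: XY matrix_mult_scaleR matrix_scaleR_mult matrix_mul_assoc)
    finally show ?thesis by (simp add: K_def dot AiA)
  qed
  have GK: "transpose G ** K = 0"
  proof -
    have "transpose G2 ** K2 = - (iA ** Y ** (Q ** transpose Q) ** X ** iA)"
      unfolding G2s by (simp add: K2_def matrix_mul_assoc matrix_mult_minus)
    also have "\<dots> = - (iA ** (Y ** iY) ** A ** (iX ** X) ** iA)"
      by (simp add: iS' matrix_mul_assoc)
    also have "\<dots> = - iA" by (simp add: YiY iAA iXX)
    finally have "P ** transpose P + transpose G2 ** K2 = 0" by (simp add: iAP[symmetric])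
    then show ?thesis by (simp add: G_def K_def dot)
  qed
  have KG: "transpose K ** G = 0"
  proof -
    have "transpose K ** G = transpose (transpose G ** K)" by (simp add: matrix_transpose_mul)
    then show ?thesis unfolding GK by (simp add: transpose_def vec_eq_iff)
  qed
  \<comment> \<open>The direction diag(x, y) seen in the coordinates (G K).\<close>
  define H where "H = G ** x ** transpose G + K ** y ** transpose K"
  have Hs: "transpose H = H"
    by (simp add: H_def transpose_add matrix_transpose_mul xs ys matrix_mul_assoc)
  \<comment> \<open>Because G^T K = 0, such sums multiply like pairs, with X^-1 and Y^-1 inserted
    between the factors. Powers of H hence reproduce the traces of the two log-determinants.\<close>
  have mult: "(G ** u ** transpose G + K ** v ** transpose K) ** (G ** u' ** transpose G + K ** v' ** transpose K)
     = G ** (u ** iX ** u') ** transpose G + K ** (v ** iY ** v') ** transpose K" for u v u' v'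
  proof -
    have "G ** u ** transpose G ** (G ** u' ** transpose G) = G ** (u ** iX ** u') ** transpose G"
      "K ** v ** transpose K ** (K ** v' ** transpose K) = K ** (v ** iY ** v') ** transpose K"
      by (simp_all add: GG[symmetric] KK[symmetric] matrix_mul_assoc)
    moreover have "G ** u ** transpose G ** (K ** v' ** transpose K) = G ** u ** (transpose G ** K) ** v' ** transpose K"
      "K ** v ** transpose K ** (G ** u' ** transpose G) = K ** v ** (transpose K ** G) ** u' ** transpose G"
      by (simp_all only: matrix_mul_assoc)
    ultimately show ?thesis
      by (simp add: matrix_add_ldistrib matrix_add_rdistrib GK KG)
  qed
  have H2: "H ** H = G ** (x ** iX ** x) ** transpose G + K ** (y ** iY ** y) ** transpose K"
    unfolding H_def by (rule mult)
  have H3: "H ** H ** H = G ** (x ** iX ** x ** iX ** x) ** transpose G + K ** (y ** iY ** y ** iY ** y) ** transpose K"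
    unfolding H2 unfolding H_def by (rule mult)
  have t2: "trace (H ** H) = trace (iX ** x ** iX ** x) + trace (iY ** y ** iY ** y)"
    unfolding H2 trace_add trace_congruence GG KK by (simp only: matrix_mul_assoc)
  have t3: "trace (H ** H ** H) = trace (iX ** x ** iX ** x ** iX ** x) + trace (iY ** y ** iY ** y ** iY ** y)"
    unfolding H3 trace_add trace_congruence GG KK by (simp only: matrix_mul_assoc)
  have blk: "(\<chi> i j. ((\<chi> i. case i of Inl j \<Rightarrow> c *\<^sub>R U $ j | Inr j \<Rightarrow> c *\<^sub>R V $ j) ** M **
      transpose (\<chi> i. case i of Inl j \<Rightarrow> c *\<^sub>R U $ j | Inr j \<Rightarrow> c *\<^sub>R V $ j)) $ Inl i $ Inl j)
      = (1/2) *\<^sub>R (U ** M ** transpose U)" for U V M :: "real^'n^'n"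
  proof -
    have *: "c * u * m * (c * v) = u * m * v / 2" for u v m
      using cc by (metis mult.assoc mult.left_commute mult.right_neutral times_divide_eq_right)
    show ?thesis
      by (simp add: vec_eq_iff matrix_matrix_mult_def transpose_def sum_distrib_right * sum_divide_distrib)
  qed
  \<comment> \<open>G and K share the upper block c P^T, so the leading block of H sees only x + y =
    2 a and is independent of b.\<close>
  have "(\<chi> i j. H $ Inl i $ Inl j) = (\<chi> i j. (G ** x ** transpose G) $ Inl i $ Inl j) + (\<chi> i j. (K ** y ** transpose K) $ Inl i $ Inl j)"
    by (simp add: H_def vec_eq_iff)
  also have "\<dots> = (1/2) *\<^sub>R (transpose P ** (x + y) ** P)"
    unfolding G_def K_def blk by (simp add: matrix_add_ldistrib matrix_add_rdistrib scaleR_add_right)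
  also have "x + y = 2 *\<^sub>R a" by (simp add: x_def y_def scaleR_2)
  finally have "(\<chi> i j. H $ Inl i $ Inl j) = \<alpha>"
    by (simp add: \<alpha>_def matrix_mult_scaleR matrix_scaleR_mult)
  then show ?thesis
    using symmetric_block_trace_bound[OF Hs] by (simp only: t2 t3)
qed

section \<open>Derivatives up to order three\<close>

text \<open>Derivatives are curried real functions of fixed directions, the most recent direction
  first, so that sums and linear substitutions can be handled pointwise. Linearity is required at
  every x, also outside S, so that \<open>Blinfun\<close> returns the intended map
  everywhere.\<close>

definition derivs3_on ::
  "'a::euclidean_space set \<Rightarrow> ('a \<Rightarrow> real) \<Rightarrow> ('a \<Rightarrow> 'a \<Rightarrow> real) \<Rightarrow> ('a \<Rightarrow> 'a \<Rightarrow> 'a \<Rightarrow> real)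
    \<Rightarrow> ('a \<Rightarrow> 'a \<Rightarrow> 'a \<Rightarrow> 'a \<Rightarrow> real) \<Rightarrow> bool" where
  "derivs3_on S F f1 f2 f3 \<longleftrightarrow>
     (\<forall>x\<in>S. (F has_derivative f1 x) (at x)) \<and>
     (\<forall>x\<in>S. \<forall>h. ((\<lambda>x. f1 x h) has_derivative (\<lambda>k. f2 x k h)) (at x)) \<and>
     (\<forall>x\<in>S. \<forall>k h. ((\<lambda>x. f2 x k h) has_derivative (\<lambda>l. f3 x l k h)) (at x)) \<and>
     (\<forall>l k h. continuous_on S (\<lambda>x. f3 x l k h)) \<and>
     (\<forall>x. linear (f1 x)) \<and>
     (\<forall>x k. linear (f2 x k)) \<and> (\<forall>x h. linear (\<lambda>k. f2 x k h)) \<and>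
     (\<forall>x l k. linear (f3 x l k)) \<and> (\<forall>x l h. linear (\<lambda>k. f3 x l k h)) \<and> (\<forall>x k h. linear (\<lambda>l. f3 x l k h))"

text \<open>On a finite-dimensional domain, convergence in operator norm can be tested on one
  argument at a time.\<close>

lemma has_derivative_blinfun_componentwise:
  fixes f :: "'a::real_normed_vector \<Rightarrow> 'b::euclidean_space \<Rightarrow>\<^sub>L 'c::real_normed_vector"
  assumes "bounded_linear f'"
    and "\<And>h. ((\<lambda>x. blinfun_apply (f x) h) has_derivative (\<lambda>k. blinfun_apply (f' k) h)) F"
  shows "(f has_derivative f') F"
  unfolding has_derivative_def
  using assms by (intro conjI tendsto_componentwise1)
    (simp_all add: has_derivative_def blinfun.scaleR_left blinfun.diff_left)

lemma blinfun_apply_Blinfun_linear: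
  fixes f :: "'a::euclidean_space \<Rightarrow> 'b::real_normed_vector"
  shows "linear f \<Longrightarrow> blinfun_apply (Blinfun f) = f"
  by (simp add: bounded_linear_Blinfun_apply linear_conv_bounded_linear)

lemma linear_Blinfun:
  fixes f :: "'c::real_vector \<Rightarrow> 'a::euclidean_space \<Rightarrow> 'b::real_normed_vector"
  assumes "\<And>k. linear (f k)" "\<And>h. linear (\<lambda>k. f k h)"
  shows "linear (\<lambda>k. Blinfun (f k))"
  by (rule linearI; rule blinfun_eqI)
    (simp_all add: blinfun_apply_Blinfun_linear assms blinfun.add_left blinfun.scaleR_left
      linear_add[OF assms(2)] linear_scale[OF assms(2)])

lemma derivs3_on_blinfun:
  fixes F :: "'a::euclidean_space \<Rightarrow> real"
  assumes "derivs3_on S F f1 f2 f3"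
  shows "\<exists>D1 D2 (D3 :: 'a \<Rightarrow> 'a \<Rightarrow>\<^sub>L 'a \<Rightarrow>\<^sub>L 'a \<Rightarrow>\<^sub>L real).
     (\<forall>x\<in>S. (F has_derivative blinfun_apply (D1 x)) (at x) \<and>
        (D1 has_derivative blinfun_apply (D2 x)) (at x) \<and>
        (D2 has_derivative blinfun_apply (D3 x)) (at x)) \<and>
     continuous_on S D3 \<and>
     (\<forall>x h. blinfun_apply (blinfun_apply (D2 x) h) h = f2 x h h) \<and>
     (\<forall>x h. blinfun_apply (blinfun_apply (blinfun_apply (D3 x) h) h) h = f3 x h h h)"
proof -
  have d: "\<And>x. x \<in> S \<Longrightarrow> (F has_derivative f1 x) (at x)"
      "\<And>x h. x \<in> S \<Longrightarrow> ((\<lambda>x. f1 x h) has_derivative (\<lambda>k. f2 x k h)) (at x)"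
      "\<And>x k h. x \<in> S \<Longrightarrow> ((\<lambda>x. f2 x k h) has_derivative (\<lambda>l. f3 x l k h)) (at x)"
    and c: "\<And>l k h. continuous_on S (\<lambda>x. f3 x l k h)"
    and l1: "\<And>x. linear (f1 x)"
    and l2: "\<And>x k. linear (f2 x k)" "\<And>x h. linear (\<lambda>k. f2 x k h)"
    and l3: "\<And>x l k. linear (f3 x l k)" "\<And>x l h. linear (\<lambda>k. f3 x l k h)" "\<And>x k h. linear (\<lambda>l. f3 x l k h)"
    using assms unfolding derivs3_on_def by auto
  define D1 where "D1 x = Blinfun (f1 x)" for x
  define D2 where "D2 x = Blinfun (\<lambda>k. Blinfun (f2 x k))" for x
  define D3 where "D3 x = Blinfun (\<lambda>l. Blinfun (\<lambda>k. Blinfun (f3 x l k)))" for x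
  have L2: "linear (\<lambda>k. Blinfun (f2 x k))" for x by (intro linear_Blinfun l2)
  have L3: "linear (\<lambda>k. Blinfun (f3 x l k))" for x l by (intro linear_Blinfun l3)
  have L3': "linear (\<lambda>l. Blinfun (\<lambda>k. Blinfun (f3 x l k)))" for x
  proof (rule linear_Blinfun[OF L3])
    show "linear (\<lambda>l. Blinfun (f3 x l k))" for k by (intro linear_Blinfun l3)
  qed
  have a1: "blinfun_apply (D1 x) h = f1 x h" for x h
    by (simp add: D1_def blinfun_apply_Blinfun_linear l1)
  have a2: "blinfun_apply (blinfun_apply (D2 x) k) h = f2 x k h" for x k h
    by (simp add: D2_def blinfun_apply_Blinfun_linear l2 L2)
  have a3: "blinfun_apply (blinfun_apply (blinfun_apply (D3 x) l) k) h = f3 x l k h" for x l k h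
    by (simp add: D3_def blinfun_apply_Blinfun_linear l3 L3 L3')
  have "(F has_derivative blinfun_apply (D1 x)) (at x)" if "x \<in> S" for x
    using d(1)[OF that] by (simp add: D1_def blinfun_apply_Blinfun_linear l1)
  moreover have "(D1 has_derivative blinfun_apply (D2 x)) (at x)" if "x \<in> S" for x
    by (rule has_derivative_blinfun_componentwise) (simp_all add: blinfun.bounded_linear_right a1 a2 d(2)[OF that])
  moreover have "(D2 has_derivative blinfun_apply (D3 x)) (at x)" if "x \<in> S" for x
  proof (rule has_derivative_blinfun_componentwise[OF blinfun.bounded_linear_right],
      rule has_derivative_blinfun_componentwise)
    show "bounded_linear (\<lambda>k. blinfun_apply (blinfun_apply (D3 x) k) h)" for h
      by (intro bounded_linear_intros)
  qed (simp add: a2 a3 d(3)[OF that])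
  moreover have "continuous_on S D3"
    by (intro continuous_on_blinfun_componentwise) (simp add: a3 c)
  ultimately show ?thesis using a2 a3 by blast
qed

section \<open>Calculus rules for third-order derivatives\<close>

lemma derivs3_on_add:
  assumes "derivs3_on S F f1 f2 f3" "derivs3_on S G g1 g2 g3"
  shows "derivs3_on S (\<lambda>x. F x + G x) (\<lambda>x h. f1 x h + g1 x h) (\<lambda>x k h. f2 x k h + g2 x k h)
    (\<lambda>x l k h. f3 x l k h + g3 x l k h)"
  using assms unfolding derivs3_on_def
  by (auto intro!: has_derivative_add continuous_on_add linear_compose_add)

lemma derivs3_on_diff:
  assumes "derivs3_on S F f1 f2 f3" "derivs3_on S G g1 g2 g3"
  shows "derivs3_on S (\<lambda>x. F x - G x) (\<lambda>x h. f1 x h - g1 x h) (\<lambda>x k h. f2 x k h - g2 x k h)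
    (\<lambda>x l k h. f3 x l k h - g3 x l k h)"
  using assms unfolding derivs3_on_def
  by (auto intro!: has_derivative_diff continuous_on_diff linear_compose_sub)

lemma derivs3_on_sum:
  assumes "\<And>i. i \<in> I \<Longrightarrow> derivs3_on S (F i) (f1 i) (f2 i) (f3 i)"
  shows "derivs3_on S (\<lambda>x. \<Sum>i\<in>I. F i x) (\<lambda>x h. \<Sum>i\<in>I. f1 i x h) (\<lambda>x k h. \<Sum>i\<in>I. f2 i x k h)
    (\<lambda>x l k h. \<Sum>i\<in>I. f3 i x l k h)"
  using assms unfolding derivs3_on_def
  by (auto intro!: has_derivative_sum continuous_on_sum linear_compose_sum)

text \<open>Second and higher derivatives of \<phi> vanish, so the chain rule produces no additional
  terms.\<close>

lemma derivs3_on_linear_compose: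
  assumes F: "derivs3_on S F f1 f2 f3" and l: "linear \<phi>" and sub: "\<And>x. x \<in> T \<Longrightarrow> \<phi> x \<in> S"
  shows "derivs3_on T (\<lambda>x. F (\<phi> x)) (\<lambda>x h. f1 (\<phi> x) (\<phi> h)) (\<lambda>x k h. f2 (\<phi> x) (\<phi> k) (\<phi> h))
    (\<lambda>x l k h. f3 (\<phi> x) (\<phi> l) (\<phi> k) (\<phi> h))"
proof -
  have d: "(\<phi> has_derivative \<phi>) (at x)" for x
    using l by (simp add: linear_imp_has_derivative)
  have c: "continuous_on T \<phi>"
    using l by (simp add: linear_continuous_on linear_conv_bounded_linear)
  have comp: "linear (\<lambda>h. g (\<phi> h))" if "linear g" for g :: "'a \<Rightarrow> real"
    using linear_compose[OF l that] by (simp add: o_def)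
  have cc: "continuous_on T (\<lambda>x. g (\<phi> x))" if "continuous_on S g" for g :: "'a \<Rightarrow> real"
    by (rule continuous_on_compose2[OF that c]) (use sub in auto)
  show ?thesis
    using F unfolding derivs3_on_def
    by (intro conjI ballI allI has_derivative_compose[OF d] comp cc) (simp_all add: sub)
qed

lemma derivs3_on_cong:
  assumes G: "derivs3_on S G f1 f2 f3" and S: "open S" and eq: "\<And>x. x \<in> S \<Longrightarrow> F x = G x"
  shows "derivs3_on S F f1 f2 f3"
proof -
  have "(F has_derivative f1 x) (at x)" if "x \<in> S" for x
    by (rule has_derivative_transform_within_open[of G _ _ _ S]) (use that G S eq in \<open>auto simp: derivs3_on_def\<close>)
  with G show ?thesis by (simp add: derivs3_on_def)
qed

text \<open>Restriction to a segment reduces the claim to the second-derivative test in one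
  variable.\<close>

lemma derivs3_on_imp_convex_on:
  assumes F: "derivs3_on S F f1 f2 f3" and S: "convex S" and pos: "\<And>x h. x \<in> S \<Longrightarrow> f2 x h h \<ge> 0"
  shows "convex_on S F"
proof (rule convex_onI[OF _ S])
  fix t x y assume t: "0 < t" "t < (1::real)" and xy: "x \<in> S" "y \<in> S"
  define \<gamma> where "\<gamma> r = x + r *\<^sub>R (y - x)" for r :: real
  have \<gamma>S: "\<gamma> r \<in> S" if "r \<in> {0..1}" for r
    using convexD_alt[OF S xy, of r] that by (simp add: \<gamma>_def algebra_simps)
  have d\<gamma>: "(\<gamma> has_derivative (\<lambda>s. s *\<^sub>R (y - x))) (at r)" for r
    unfolding \<gamma>_def by (auto intro!: derivative_eq_intros)
  have l: "linear (f1 u)" "linear (\<lambda>k. f2 u k h)" for u h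
    using F by (simp_all add: derivs3_on_def)
  have "convex_on {0..1} (\<lambda>r. F (\<gamma> r))"
  proof (rule f''_ge0_imp_convex)
    fix r :: real assume r: "r \<in> {0..1}"
    have "((\<lambda>r. F (\<gamma> r)) has_derivative (\<lambda>s. f1 (\<gamma> r) (s *\<^sub>R (y - x)))) (at r)"
      using F \<gamma>S[OF r] by (intro has_derivative_compose[OF d\<gamma>]) (simp add: derivs3_on_def)
    then show "DERIV (\<lambda>r. F (\<gamma> r)) r :> f1 (\<gamma> r) (y - x)"
      by (rule has_derivative_imp_has_field_derivative) (simp add: linear_scale[OF l(1)])
    have "((\<lambda>r. f1 (\<gamma> r) (y - x)) has_derivative (\<lambda>s. f2 (\<gamma> r) (s *\<^sub>R (y - x)) (y - x))) (at r)"
      using F \<gamma>S[OF r] by (intro has_derivative_compose[OF d\<gamma>]) (simp add: derivs3_on_def)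
    then show "DERIV (\<lambda>r. f1 (\<gamma> r) (y - x)) r :> f2 (\<gamma> r) (y - x) (y - x)"
      by (rule has_derivative_imp_has_field_derivative) (simp add: linear_scale[OF l(2)])
    show "f2 (\<gamma> r) (y - x) (y - x) \<ge> 0" by (rule pos[OF \<gamma>S[OF r]])
  qed simp
  from convex_onD[OF this, of t 0 1] t
  show "F ((1 - t) *\<^sub>R x + t *\<^sub>R y) \<le> (1 - t) * F x + t * F y"
    by (simp add: \<gamma>_def algebra_simps)
qed

text \<open>The third derivative has one term for each of the two inverses in the second. On equal
  directions they coincide and give -2 tr ((X^-1 H)^3).\<close>

lemma derivs3_on_neg_ln_det:
  "derivs3_on {X :: real^'n^'n. det X > 0} (\<lambda>X. - ln (det X)) (\<lambda>X H. - trace (matrix_inv X ** H))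
    (\<lambda>X K H. trace (matrix_inv X ** K ** matrix_inv X ** H))
    (\<lambda>X L K H. - trace (matrix_inv X ** L ** matrix_inv X ** K ** matrix_inv X ** H)
              - trace (matrix_inv X ** K ** matrix_inv X ** L ** matrix_inv X ** H))"
proof -
  have inv: "(matrix_inv has_derivative (\<lambda>H. - (matrix_inv X ** H ** matrix_inv X))) (at X)" if "det X > 0" for X :: "real^'n^'n"
    using that by (intro has_derivative_matrix_inv) simp
  have cinv: "continuous_on {X. det X > 0} (matrix_inv :: real^'n^'n \<Rightarrow> _)"
    by (rule has_derivative_continuous_on[OF has_derivative_at_withinI[OF inv]]) simp
  have lin: "linear (\<lambda>H. trace (U ** H ** V))" "linear (\<lambda>H. trace (U ** H))" "linear (\<lambda>H. - trace (U ** H))" for U V :: "real^'n^'n"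
    by (rule linearI; simp add: matrix_add_ldistrib matrix_add_rdistrib matrix_mult_scaleR matrix_scaleR_mult trace_add trace_scaleR)+
  have lin': "linear (\<lambda>H. - trace (U ** H ** V) - trace (U' ** H ** V'))" "linear (\<lambda>H. - trace (U ** H) - trace (U' ** H))"
    for U V U' V' :: "real^'n^'n"
    by (rule linearI; simp add: matrix_add_ldistrib matrix_add_rdistrib matrix_mult_scaleR matrix_scaleR_mult trace_add trace_scaleR algebra_simps)+
  show ?thesis
    unfolding derivs3_on_def
  proof (intro conjI allI ballI)
    fix X K H L :: "real^'n^'n"
    { fix X :: "real^'n^'n" assume "X \<in> {X. det X > 0}"
      then have X: "det X > 0" by simp
      show "((\<lambda>X. - ln (det X)) has_derivative (\<lambda>H. - trace (matrix_inv X ** H))) (at X)"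
        by (intro has_derivative_minus has_derivative_ln_det X)
      from has_derivative_minus[OF has_derivative_trace[OF has_derivative_matrix_mult[OF inv[OF X] has_derivative_const[of H]]]]
      show "((\<lambda>X. - trace (matrix_inv X ** H)) has_derivative (\<lambda>K. trace (matrix_inv X ** K ** matrix_inv X ** H))) (at X)"
        by (simp add: matrix_minus_mult trace_uminus)
      from has_derivative_trace[OF has_derivative_matrix_mult[OF has_derivative_matrix_mult[OF has_derivative_matrix_mult[OF inv[OF X] has_derivative_const[of K]] inv[OF X]] has_derivative_const[of H]]]
      show "((\<lambda>X. trace (matrix_inv X ** K ** matrix_inv X ** H)) has_derivative
        (\<lambda>L. - trace (matrix_inv X ** L ** matrix_inv X ** K ** matrix_inv X ** H)
              - trace (matrix_inv X ** K ** matrix_inv X ** L ** matrix_inv X ** H))) (at X)"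
        by (simp add: matrix_minus_mult matrix_mult_minus matrix_add_rdistrib matrix_diff_rdistrib trace_uminus trace_add trace_sub matrix_mul_assoc algebra_simps) }
    show "continuous_on {X. det X > 0} (\<lambda>X. - trace (matrix_inv X ** L ** matrix_inv X ** K ** matrix_inv X ** H)
              - trace (matrix_inv X ** K ** matrix_inv X ** L ** matrix_inv X ** H))"
      by (intro continuous_intros cinv)
    show "linear (\<lambda>H. - trace (matrix_inv X ** H))"
      "linear (\<lambda>H. trace (matrix_inv X ** K ** matrix_inv X ** H))"
      by (rule lin)+
    show "linear (\<lambda>K. trace (matrix_inv X ** K ** matrix_inv X ** H))"
      using lin(1)[of "matrix_inv X" "matrix_inv X ** H"] by (simp add: matrix_mul_assoc)
    show "linear (\<lambda>H. - trace (matrix_inv X ** L ** matrix_inv X ** K ** matrix_inv X ** H)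
              - trace (matrix_inv X ** K ** matrix_inv X ** L ** matrix_inv X ** H))"
      by (rule lin')
    show "linear (\<lambda>K. - trace (matrix_inv X ** L ** matrix_inv X ** K ** matrix_inv X ** H)
              - trace (matrix_inv X ** K ** matrix_inv X ** L ** matrix_inv X ** H))"
      using lin'(1)[of "matrix_inv X ** L ** matrix_inv X" "matrix_inv X ** H" "matrix_inv X" "matrix_inv X ** L ** matrix_inv X ** H"]
      by (simp add: matrix_mul_assoc)
    show "linear (\<lambda>L. - trace (matrix_inv X ** L ** matrix_inv X ** K ** matrix_inv X ** H)
              - trace (matrix_inv X ** K ** matrix_inv X ** L ** matrix_inv X ** H))"
      using lin'(1)[of "matrix_inv X" "matrix_inv X ** K ** matrix_inv X ** H" "matrix_inv X ** K ** matrix_inv X" "matrix_inv X ** H"]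
      by (simp add: matrix_mul_assoc)
  qed
qed

text \<open>Let s be the Euclidean norm of the family \<sigma>. It dominates each \<sigma> i, so the
  sum of cubes is at most s^3, and the family may be replaced by a single component with norm s and
  weight v.\<close>

lemma self_concordance_combination:
  fixes \<alpha> :: real and \<sigma> w :: "'i \<Rightarrow> real"
  assumes \<alpha>: "\<alpha> \<ge> 0" and \<sigma>: "\<And>i. i \<in> I \<Longrightarrow> \<sigma> i \<ge> 0" and w: "\<And>i. i \<in> I \<Longrightarrow> w i \<ge> 0" and I: "finite I"
  shows "\<alpha> ^ 3 + (\<Sum>i\<in>I. (\<sigma> i) ^ 3 + 3 / 2 * (\<sigma> i + \<alpha>) * w i)
    \<le> (\<alpha>\<^sup>2 + (\<Sum>i\<in>I. (\<sigma> i)\<^sup>2 + w i)) powr (3/2)"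
proof -
  define s where "s = sqrt (\<Sum>i\<in>I. (\<sigma> i)\<^sup>2)"
  define v where "v = (\<Sum>i\<in>I. w i)"
  have s2: "s\<^sup>2 = (\<Sum>i\<in>I. (\<sigma> i)\<^sup>2)" and s0: "s \<ge> 0" and v0: "v \<ge> 0"
    using w by (simp_all add: s_def v_def sum_nonneg)
  have le: "\<sigma> i \<le> s" if "i \<in> I" for i
    unfolding s_def by (rule real_le_rsqrt, rule member_le_sum) (use that I in auto)
  define M where "M = sqrt (\<alpha>\<^sup>2 + s\<^sup>2 + v)"
  have M2: "M\<^sup>2 = \<alpha>\<^sup>2 + s\<^sup>2 + v" and M0: "M \<ge> 0"
    using v0 by (simp_all add: M_def)
  have "(\<Sum>i\<in>I. (\<sigma> i) ^ 3 + 3 / 2 * (\<sigma> i + \<alpha>) * w i) \<le> (\<Sum>i\<in>I. s * (\<sigma> i)\<^sup>2 + 3 / 2 * (s + \<alpha>) * w i)"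
    using le w \<alpha> by (intro sum_mono add_mono mult_right_mono)
      (auto simp: power3_eq_cube power2_eq_square mult.assoc intro!: mult_right_mono)
  also have "\<dots> = s ^ 3 + 3 / 2 * (s + \<alpha>) * v"
  proof -
    have "(\<Sum>i\<in>I. s * (\<sigma> i)\<^sup>2) = s ^ 3"
      using s2 by (simp add: sum_distrib_left[symmetric] power2_eq_square power3_eq_cube)
    moreover have "(\<Sum>i\<in>I. 3 / 2 * (s + \<alpha>) * w i) = 3 / 2 * (s + \<alpha>) * v"
      by (simp only: v_def sum_distrib_left)
    ultimately show ?thesis by (simp only: sum.distrib)
  qed
  finally have "\<alpha> ^ 3 + (\<Sum>i\<in>I. (\<sigma> i) ^ 3 + 3 / 2 * (\<sigma> i + \<alpha>) * w i) \<le> \<alpha> ^ 3 + s ^ 3 + 3 / 2 * (s + \<alpha>) * v"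
    by simp
  also have "\<dots> \<le> M ^ 3"
  proof -
    \<comment> \<open>With z = \<alpha> + s and v eliminated, twice the left side is 3 z M^2 - z^3,
      by \<alpha>^3 + s^3 = z^3 - 3 \<alpha> s z.\<close>
    have v: "v = M\<^sup>2 - \<alpha>\<^sup>2 - s\<^sup>2" by (simp add: M2)
    have "2 * M ^ 3 - 2 * (\<alpha> ^ 3 + s ^ 3 + 3 / 2 * (s + \<alpha>) * v) = (\<alpha> + s - M)\<^sup>2 * (\<alpha> + s + 2 * M)"
      unfolding v by (simp add: power2_eq_square power3_eq_cube field_simps)
    also have "\<dots> \<ge> 0" using \<alpha> s0 M0 by simp
    finally show ?thesis by simp
  qed
  also have "M ^ 3 = (M\<^sup>2) powr (3/2)"
  \<comment> \<open>The laws of \<open>powr\<close> need a positive base; for M = 0 both sides are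
    0.\<close>
  proof (cases "M = 0")
    case False
    then have "M > 0" using M0 by simp
    then show ?thesis by (simp add: powr_powr powr_realpow[symmetric] del: powr_numeral)
  qed simp
  also have "M\<^sup>2 = \<alpha>\<^sup>2 + (\<Sum>i\<in>I. (\<sigma> i)\<^sup>2 + w i)" by (simp add: M2 s2 v_def sum.distrib)
  finally show ?thesis .
qed

section \<open>Polynomials and the map \<Lambda>\<close>

text \<open>Over an infinite index set the sum in \<open>poly_fun_deg\<close> would be 0 by
  default.\<close>

lemma finite_multidegree_le: "finite {\<alpha> :: 'n::finite \<Rightarrow> nat. sum \<alpha> UNIV \<le> k}"
proof (rule finite_subset)
  show "{\<alpha> :: 'n \<Rightarrow> nat. sum \<alpha> UNIV \<le> k} \<subseteq> PiE UNIV (\<lambda>_. {..k})"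
  proof
    fix \<alpha> :: "'n \<Rightarrow> nat" assume \<alpha>: "\<alpha> \<in> {\<alpha>. sum \<alpha> UNIV \<le> k}"
    have "\<alpha> i \<le> k" for i
    proof -
      have "\<alpha> i \<le> sum \<alpha> UNIV" by (rule member_le_sum) auto
      also have "\<dots> \<le> k" using \<alpha> by simp
      finally show ?thesis .
    qed
    then show "\<alpha> \<in> PiE UNIV (\<lambda>_. {..k})" by (simp add: PiE_iff)
  qed
  show "finite (PiE (UNIV :: 'n set) (\<lambda>_. {..k}))" by (intro finite_PiE) auto
qed

lemma poly_fun_deg_mono:
  fixes f :: "real^'n \<Rightarrow> real"
  assumes "poly_fun_deg k f" "k \<le> m"
  shows "poly_fun_deg m f"
proof -
  obtain c where c: "f = (\<lambda>x. \<Sum>\<alpha>\<in>{\<alpha>. sum \<alpha> UNIV \<le> k}. c \<alpha> * (\<Prod>i\<in>UNIV. (x $ i) ^ \<alpha> i))"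
    using assms by (auto simp: poly_fun_deg_def)
  have "f = (\<lambda>x. \<Sum>\<alpha>\<in>{\<alpha>. sum \<alpha> UNIV \<le> m}. (if sum \<alpha> UNIV \<le> k then c \<alpha> else 0) * (\<Prod>i\<in>UNIV. (x $ i) ^ \<alpha> i))"
    unfolding c using assms(2)
    by (intro ext sum.mono_neutral_cong_left) (auto simp: finite_multidegree_le)
  then show ?thesis unfolding poly_fun_deg_def by (intro exI)
qed

lemma poly_fun_deg_linear_combination:
  fixes f :: "'l::finite \<Rightarrow> real^'n \<Rightarrow> real"
  assumes "\<And>l. poly_fun_deg k (f l)"
  shows "poly_fun_deg k (\<lambda>x. \<Sum>l\<in>UNIV. a l * f l x)"
proof -
  have "\<forall>l. \<exists>c. f l = (\<lambda>x. \<Sum>\<alpha>\<in>{\<alpha>. sum \<alpha> UNIV \<le> k}. c \<alpha> * (\<Prod>i\<in>UNIV. (x $ i) ^ \<alpha> i))"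
    using assms by (simp add: poly_fun_deg_def)
  from choice[OF this] obtain c where c: "\<And>l. f l = (\<lambda>x. \<Sum>\<alpha>\<in>{\<alpha>. sum \<alpha> UNIV \<le> k}. c l \<alpha> * (\<Prod>i\<in>UNIV. (x $ i) ^ \<alpha> i))"
    by blast
  have "(\<lambda>x. \<Sum>l\<in>UNIV. a l * f l x) = (\<lambda>x. \<Sum>\<alpha>\<in>{\<alpha>. sum \<alpha> UNIV \<le> k}. (\<Sum>l\<in>UNIV. a l * c l \<alpha>) * (\<Prod>i\<in>UNIV. (x $ i) ^ \<alpha> i))"
    unfolding c sum_distrib_left sum_distrib_right by (subst sum.swap) (simp add: mult.assoc)
  then show ?thesis unfolding poly_fun_deg_def by (intro exI)
qed

lemma Lam_nth: "Lam t p s $ i $ j = (\<Sum>u\<in>UNIV. p i (t u) * s $ u * p j (t u))"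
proof -
  have "(\<Sum>k\<in>UNIV. p i (t k) * (if k = u then s $ k else 0)) = (\<Sum>k\<in>UNIV. if k = u then p i (t k) * s $ k else 0)" for u
    by (intro sum.cong) auto
  then show ?thesis
    by (simp add: Lam_def Pmat_def matrix_matrix_mult_def transpose_def)
qed

lemma linear_Lam: "linear (Lam t p)"
  by (rule linearI) (simp_all add: vec_eq_iff Lam_nth sum.distrib sum_distrib_left algebra_simps)

lemma transpose_Lam: "transpose (Lam t p s) = Lam t p s"
  by (simp add: vec_eq_iff transpose_def Lam_nth mult_ac)

text \<open>The inner sum is the value at t u of the polynomial with coefficient vector x, so the
  form is a weighted sum of squared point values.\<close>

lemma inner_Lam: "x \<bullet> (Lam t p s *v x) = (\<Sum>u\<in>UNIV. s $ u * (\<Sum>l\<in>UNIV. x $ l * p l (t u))\<^sup>2)"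
proof -
  have "x \<bullet> (Lam t p s *v x) = (\<Sum>i\<in>UNIV. \<Sum>j\<in>UNIV. \<Sum>u\<in>UNIV. s $ u * ((x $ i * p i (t u)) * (x $ j * p j (t u))))"
    by (simp add: inner_vec_def matrix_vector_mult_def Lam_nth sum_distrib_left sum_distrib_right mult_ac)
  also have "\<dots> = (\<Sum>i\<in>UNIV. \<Sum>u\<in>UNIV. \<Sum>j\<in>UNIV. s $ u * ((x $ i * p i (t u)) * (x $ j * p j (t u))))"
    by (intro sum.cong refl sum.swap)
  also have "\<dots> = (\<Sum>u\<in>UNIV. \<Sum>i\<in>UNIV. \<Sum>j\<in>UNIV. s $ u * ((x $ i * p i (t u)) * (x $ j * p j (t u))))"
    by (rule sum.swap)
  finally show ?thesis
    by (simp only: power2_eq_square sum_product) (simp only: sum_distrib_left)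
qed

text \<open>If the form vanishes at x, the polynomial with coefficients x vanishes at all points;
  unisolvence makes it zero and independence of the basis gives x = 0. This yields a point of the
  domain.\<close>

lemma pos_def_Lam_1:
  fixes t :: "'u::finite \<Rightarrow> real^'n" and p :: "'l::finite \<Rightarrow> real^'n \<Rightarrow> real"
  assumes t: "unisolvent (2 * d) t" and p: "poly_basis d p"
  shows "pos_def (Lam t p 1)"
proof -
  have "x \<bullet> (Lam t p 1 *v x) > 0" if "x \<noteq> 0" for x
  proof -
    have "\<exists>u. (\<Sum>l\<in>UNIV. x $ l * p l (t u)) \<noteq> 0"
    proof (rule ccontr)
      assume *: "\<not> ?thesis"
      have "poly_fun_deg (2 * d) (\<lambda>y. \<Sum>l\<in>UNIV. x $ l * p l y)"
        by (rule poly_fun_deg_mono[of d], rule poly_fun_deg_linear_combination) (use p in \<open>simp_all add: poly_basis_def\<close>)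
      with t * have "(\<lambda>y. \<Sum>l\<in>UNIV. x $ l * p l y) = (\<lambda>_. 0)"
        by (simp add: unisolvent_def)
      with p have "\<forall>l. x $ l = 0" unfolding poly_basis_def by blast
      with that show False by (simp add: vec_eq_iff)
    qed
    then obtain u where "(\<Sum>l\<in>UNIV. x $ l * p l (t u)) \<noteq> 0" ..
    then show ?thesis
      unfolding inner_Lam by (intro sum_pos2[of _ u]) auto
  qed
  then show ?thesis by (simp add: pos_def_def transpose_Lam)
qed

section \<open>The barrier\<close>

text \<open>One summand tends to infinity; the common bound C keeps the others from compensating
  it.\<close>

lemma filterlim_neg_sum_ln_at_top:
  fixes d :: "'i \<Rightarrow> nat \<Rightarrow> real"
  assumes I: "finite I" and j: "j \<in> I" and pos: "\<And>i k. i \<in> I \<Longrightarrow> d i k > 0"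
    and bd: "\<And>i k. i \<in> I \<Longrightarrow> d i k \<le> C" and lim: "d j \<longlonglongrightarrow> 0"
  shows "filterlim (\<lambda>k. - (\<Sum>i\<in>I. ln (d i k))) at_top sequentially"
proof -
  have "filterlim (d j) (at_right 0) sequentially"
    using lim pos[OF j] by (simp add: filterlim_at less_imp_neq[symmetric])
  then have "filterlim (\<lambda>k. ln (d j k)) at_bot sequentially"
    by (rule filterlim_compose[OF ln_at_0])
  then have "filterlim (\<lambda>k. - ln (d j k)) at_top sequentially"
    by (simp add: filterlim_uminus_at_top)
  then have "filterlim (\<lambda>k. - (\<Sum>i\<in>I - {j}. ln C) + - ln (d j k)) at_top sequentially"
    by (intro filterlim_tendsto_add_at_top[OF tendsto_const])
  then show ?thesis
  proof (rule filterlim_at_top_mono, intro always_eventually allI)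
    fix k
    have "(\<Sum>i\<in>I. ln (d i k)) = ln (d j k) + (\<Sum>i\<in>I - {j}. ln (d i k))"
      using I j by (rule sum.remove)
    moreover have "(\<Sum>i\<in>I - {j}. ln (d i k)) \<le> (\<Sum>i\<in>I - {j}. ln C)"
      using pos bd by (intro sum_mono ln_mono) auto
    ultimately show "- (\<Sum>i\<in>I - {j}. ln C) + - ln (d j k) \<le> - (\<Sum>i\<in>I. ln (d i k))" by simp
  qed
qed

section \<open>The domain and the barrier in terms of linear maps\<close>

lemma linear_Lam_nth:
  "linear (\<lambda>s. Lam t p (s $ i))"
  "linear (\<lambda>s. Lam t p (s $ i + s $ j))"
  "linear (\<lambda>s. Lam t p (s $ i - s $ j))"
  by (rule linearI; simp add: linear_add[OF linear_Lam] linear_diff[OF linear_Lam] linear_scale[OF linear_Lam] algebra_simps)+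

text \<open>As an intersection of preimages of the positive definite cone under linear maps, the
  domain inherits openness, convexity and invariance under positive scaling.\<close>

lemma Kdom_eq:
  "Kdom t p i1 = {s. pos_def (Lam t p (s $ i1)) \<and>
     (\<forall>i. i \<noteq> i1 \<longrightarrow> pos_def (Lam t p (s $ i1 + s $ i)) \<and> pos_def (Lam t p (s $ i1 - s $ i)))}"
proof -
  have "pos_def (schur t p a b) \<longleftrightarrow> pos_def (Lam t p (a + b)) \<and> pos_def (Lam t p (a - b))"
    if "pos_def (Lam t p a)" for a b
    using pos_def_schur_iff[OF transpose_Lam, of "Lam t p a" t p b] that
    by (simp add: schur_def linear_add[OF linear_Lam] linear_diff[OF linear_Lam])
  then show ?thesis unfolding Kdom_def by blast
qed

lemma Kdom_eq_INT:
  "Kdom t p i1 = {s. pos_def (Lam t p (s $ i1))} \<inter>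
     (\<Inter>i\<in>- {i1}. {s. pos_def (Lam t p (s $ i1 + s $ i))} \<inter> {s. pos_def (Lam t p (s $ i1 - s $ i))})"
  by (auto simp: Kdom_eq)

lemma open_Kdom: "open (Kdom t p i1)"
  unfolding Kdom_eq_INT
  by (intro open_Int open_INT ballI open_pos_def_linear linear_Lam_nth transpose_Lam) simp

lemma convex_pos_def_linear: "linear \<phi> \<Longrightarrow> convex {s. pos_def (\<phi> s)}"
  using convex_linear_vimage[OF _ convex_pos_def, of \<phi>] by (simp add: vimage_def)

lemma convex_Kdom: "convex (Kdom t p i1)"
  unfolding Kdom_eq_INT
  by (intro convex_Int convex_INT convex_pos_def_linear linear_Lam_nth)

lemma Kdom_scaleR:
  assumes "s \<in> Kdom t p i1" "c > 0"
  shows "c *\<^sub>R s \<in> Kdom t p i1"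
  using assms
  by (simp add: Kdom_eq linear_scale[OF linear_Lam] pos_def_scaleR
      flip: scaleR_add_right scaleR_diff_right)

lemma det_schur_Lam:
  assumes "pos_def (Lam t p a)"
  shows "det (schur t p a b) = det (Lam t p (a + b)) * det (Lam t p (a - b)) / det (Lam t p a)"
  using det_schur[of "Lam t p a" "Lam t p b"] pos_def_det_pos[OF assms]
  by (simp add: schur_def linear_add[OF linear_Lam] linear_diff[OF linear_Lam])

text \<open>The double minus keeps -log det as the only building block, so that the rules for sums
  and differences of \<open>derivs3_on\<close> apply directly.\<close>

lemma Fbar_eq:
  assumes s: "s \<in> Kdom t p i1"
  shows "Fbar t p i1 s = - ln (det (Lam t p (s $ i1))) +
    (\<Sum>i\<in>UNIV - {i1}. - ln (det (Lam t p (s $ i1 + s $ i))) + - ln (det (Lam t p (s $ i1 - s $ i)))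
       - - ln (det (Lam t p (s $ i1))))"
proof -
  have "ln (det (schur t p (s $ i1) (s $ i))) = ln (det (Lam t p (s $ i1 + s $ i))) + ln (det (Lam t p (s $ i1 - s $ i)))
     - ln (det (Lam t p (s $ i1)))" if "i \<noteq> i1" for i
  proof -
    have *: "det (Lam t p (s $ i1)) > 0" "det (Lam t p (s $ i1 + s $ i)) > 0" "det (Lam t p (s $ i1 - s $ i)) > 0"
      using s that by (auto simp: Kdom_eq intro!: pos_def_det_pos)
    show ?thesis
      using s * by (simp add: det_schur_Lam Kdom_eq ln_div ln_mult)
  qed
  then have "(\<Sum>i\<in>UNIV - {i1}. - ln (det (Lam t p (s $ i1 + s $ i))) + - ln (det (Lam t p (s $ i1 - s $ i)))
       - - ln (det (Lam t p (s $ i1)))) = (\<Sum>i\<in>UNIV - {i1}. - ln (det (schur t p (s $ i1) (s $ i))))"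
    by (intro sum.cong) auto
  then show ?thesis by (simp add: Fbar_def sum_negf)
qed

text \<open>The kept copy of -log det A contributes L, and each of the m - 1 pairs contributes L + L
  - L.\<close>

lemma Fbar_log_homogeneous:
  fixes t :: "'u::finite \<Rightarrow> real^'n" and p :: "'l::finite \<Rightarrow> real^'n \<Rightarrow> real" and i1 :: "'m::finite"
  assumes s: "s \<in> Kdom t p i1" and c: "c > 0"
  shows "Fbar t p i1 (c *\<^sub>R s) = Fbar t p i1 s - real (CARD('l) * CARD('m)) * ln c"
proof -
  have ln: "- ln (det (Lam t p (c *\<^sub>R a))) = - ln (det (Lam t p a)) - real CARD('l) * ln c" if "pos_def (Lam t p a)" for a
  proof -
    have "det (Lam t p (c *\<^sub>R a)) = c ^ CARD('l) * det (Lam t p a)"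
      by (simp add: linear_scale[OF linear_Lam] det_scaleR_matrix)
    with c pos_def_det_pos[OF that] show ?thesis by (simp add: ln_mult ln_realpow)
  qed
  have pd: "pos_def (Lam t p (s $ i1))"
    "\<And>i. i \<in> UNIV - {i1} \<Longrightarrow> pos_def (Lam t p (s $ i1 + s $ i))" "\<And>i. i \<in> UNIV - {i1} \<Longrightarrow> pos_def (Lam t p (s $ i1 - s $ i))"
    using s by (auto simp: Kdom_eq)
  have "Fbar t p i1 (c *\<^sub>R s) = - ln (det (Lam t p (s $ i1))) - real CARD('l) * ln c +
    (\<Sum>i\<in>UNIV - {i1}. (- ln (det (Lam t p (s $ i1 + s $ i))) + - ln (det (Lam t p (s $ i1 - s $ i)))
       - - ln (det (Lam t p (s $ i1)))) - real CARD('l) * ln c)"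
    unfolding Fbar_eq[OF Kdom_scaleR[OF s c]] vector_scaleR_component scaleR_add_right[symmetric] scaleR_diff_right[symmetric]
    by (intro arg_cong2[of _ _ _ _ "(+)"] sum.cong) (simp_all add: ln pd del: minus_add_distrib)
  also have "\<dots> = Fbar t p i1 s - real CARD('l) * ln c - real (CARD('m) - 1) * (real CARD('l) * ln c)"
    unfolding Fbar_eq[OF s] sum_subtractf[of _ "\<lambda>_. real CARD('l) * ln c"] by (simp add: card_Diff_singleton)
  also have "real (CARD('m) - 1) = real CARD('m) - 1"
    by (simp add: of_nat_diff Suc_leI)
  finally show ?thesis by (simp add: algebra_simps)
qed

lemma Fbar_derivatives:
  fixes t :: "'u::finite \<Rightarrow> real^'n" and p :: "'l::finite \<Rightarrow> real^'n \<Rightarrow> real" and i1 :: "'m::finite"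
  obtains f1 f2 f3 where "derivs3_on (Kdom t p i1) (Fbar t p i1) f1 f2 f3"
    and "\<And>s h. s \<in> Kdom t p i1 \<Longrightarrow> f2 s h h \<ge> 0"
    and "\<And>s h. s \<in> Kdom t p i1 \<Longrightarrow> \<bar>f3 s h h h\<bar> \<le> 2 * f2 s h h powr (3/2)"
proof -
  define g1 where "g1 X H = - trace (matrix_inv X ** H)" for X H :: "real^'l^'l"
  define g2 where "g2 X K H = trace (matrix_inv X ** K ** matrix_inv X ** H)" for X K H :: "real^'l^'l"
  define g3 where "g3 X L K H = - trace (matrix_inv X ** L ** matrix_inv X ** K ** matrix_inv X ** H)
              - trace (matrix_inv X ** K ** matrix_inv X ** L ** matrix_inv X ** H)" for X L K H :: "real^'l^'l"
  define A where "A s = Lam t p (s $ i1)" for s :: "real^'u^'m"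
  define X where "X i s = Lam t p (s $ i1 + s $ i)" for i :: 'm and s :: "real^'u^'m"
  define Y where "Y i s = Lam t p (s $ i1 - s $ i)" for i :: 'm and s :: "real^'u^'m"
  define f1 where "f1 s h = g1 (A s) (A h) + (\<Sum>i\<in>UNIV - {i1}. g1 (X i s) (X i h) + g1 (Y i s) (Y i h) - g1 (A s) (A h))" for s h
  define f2 where "f2 s k h = g2 (A s) (A k) (A h) +
    (\<Sum>i\<in>UNIV - {i1}. g2 (X i s) (X i k) (X i h) + g2 (Y i s) (Y i k) (Y i h) - g2 (A s) (A k) (A h))" for s k h
  define f3 where "f3 s l k h = g3 (A s) (A l) (A k) (A h) +
    (\<Sum>i\<in>UNIV - {i1}. g3 (X i s) (X i l) (X i k) (X i h) + g3 (Y i s) (Y i l) (Y i k) (Y i h) - g3 (A s) (A l) (A k) (A h))" for s l k h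
  have lin: "linear A" "\<And>i. linear (X i)" "\<And>i. linear (Y i)"
    unfolding A_def X_def Y_def by (rule linear_Lam_nth)+
  have pd: "pos_def (A s)" "\<And>i. i \<in> UNIV - {i1} \<Longrightarrow> pos_def (X i s)" "\<And>i. i \<in> UNIV - {i1} \<Longrightarrow> pos_def (Y i s)"
    if "s \<in> Kdom t p i1" for s
    using that by (auto simp: Kdom_eq A_def X_def Y_def)
  have base: "derivs3_on {X. det X > 0} (\<lambda>X. - ln (det X)) g1 g2 g3"
    using derivs3_on_neg_ln_det unfolding g1_def g2_def g3_def .
  have "derivs3_on (Kdom t p i1) (\<lambda>s. - ln (det (A s)) +
      (\<Sum>i\<in>UNIV - {i1}. - ln (det (X i s)) + - ln (det (Y i s)) - - ln (det (A s)))) f1 f2 f3"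
    unfolding f1_def f2_def f3_def
    by (intro derivs3_on_add derivs3_on_sum derivs3_on_diff derivs3_on_linear_compose[OF base] lin)
      (auto intro!: pos_def_det_pos pd)
  then have "derivs3_on (Kdom t p i1) (Fbar t p i1) f1 f2 f3"
    by (rule derivs3_on_cong[OF _ open_Kdom]) (simp only: Fbar_eq A_def X_def Y_def)
  moreover have "f2 s h h \<ge> 0 \<and> \<bar>f3 s h h h\<bar> \<le> 2 * f2 s h h powr (3/2)" if s: "s \<in> Kdom t p i1" for s h
  proof -
    \<comment> \<open>P depends on the distinguished component alone, so the same \<alpha> appears
      in the estimates for all i.\<close>
    obtain P :: "real^'l^'l" where P: "transpose P ** A s ** P = mat 1"
      using pos_def_congruent_mat1[OF pd(1)[OF s]] .
    define \<alpha> where "\<alpha> = transpose P ** A h ** P"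
    have iA: "matrix_inv (A s) = P ** transpose P" by (rule matrix_inv_congruent_mat1[OF P])
    have \<alpha>s: "transpose \<alpha> = \<alpha>"
      by (simp add: \<alpha>_def matrix_transpose_mul A_def transpose_Lam matrix_mul_assoc)
    have A2: "g2 (A s) (A h) (A h) = (norm \<alpha>)\<^sup>2"
    proof -
      have "g2 (A s) (A h) (A h) = trace (P ** (transpose P ** A h ** P ** transpose P ** A h))"
        by (simp add: g2_def iA matrix_mul_assoc)
      also have "\<dots> = trace (\<alpha> ** transpose \<alpha>)"
        unfolding \<alpha>s unfolding \<alpha>_def by (subst trace_mul_sym) (simp add: matrix_mul_assoc)
      finally show ?thesis by (simp add: norm_matrix_sq_trace)
    qed
    have A3: "g3 (A s) (A h) (A h) (A h) = - 2 * trace (\<alpha> ** \<alpha> ** \<alpha>)"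
    proof -
      have "g3 (A s) (A h) (A h) (A h) = - 2 * trace (P ** (transpose P ** A h ** P ** transpose P ** A h ** P ** transpose P ** A h))"
        by (simp add: g3_def iA matrix_mul_assoc)
      also have "\<dots> = - 2 * trace (\<alpha> ** \<alpha> ** \<alpha>)"
        unfolding \<alpha>_def by (subst trace_mul_sym) (simp add: matrix_mul_assoc)
      finally show ?thesis .
    qed
    have "\<exists>\<sigma> w. 0 \<le> \<sigma> \<and> 0 \<le> w
        \<and> g2 (X i s) (X i h) (X i h) + g2 (Y i s) (Y i h) (Y i h) - g2 (A s) (A h) (A h) = \<sigma>\<^sup>2 + w
        \<and> \<bar>g3 (X i s) (X i h) (X i h) (X i h) + g3 (Y i s) (Y i h) (Y i h) (Y i h) - g3 (A s) (A h) (A h) (A h)\<bar>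
          \<le> 2 * (\<sigma> ^ 3 + 3 / 2 * (\<sigma> + norm \<alpha>) * w)" if i: "i \<in> UNIV - {i1}" for i
    proof -
      have XY: "X i r = A r + Lam t p (r $ i)" "Y i r = A r - Lam t p (r $ i)" for r
        by (simp_all add: X_def Y_def A_def linear_add[OF linear_Lam] linear_diff[OF linear_Lam])
      have As: "transpose (A r) = A r" for r by (simp add: A_def transpose_Lam)
      \<comment> \<open>On equal directions \<open>g3\<close> is -2 times the trace of a cube, which
        explains the halves below and the factor 2 in the bound.\<close>
      from logdet_pair_trace_bound[where A = "A s" and B = "Lam t p (s $ i)" and a = "A h" and b = "Lam t p (h $ i)" and P = P,
          folded XY \<alpha>_def, OF As transpose_Lam As transpose_Lam pd(2,3)[OF s i] P]
      obtain \<sigma> w where *: "0 \<le> \<sigma>" "0 \<le> w"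
        "g2 (X i s) (X i h) (X i h) + g2 (Y i s) (Y i h) (Y i h) = (norm \<alpha>)\<^sup>2 + \<sigma>\<^sup>2 + w"
        "\<bar>- g3 (X i s) (X i h) (X i h) (X i h) / 2 + - g3 (Y i s) (Y i h) (Y i h) (Y i h) / 2 - trace (\<alpha> ** \<alpha> ** \<alpha>)\<bar>
          \<le> \<sigma> ^ 3 + 3 / 2 * (\<sigma> + norm \<alpha>) * w"
        by (auto simp: g2_def g3_def)
      show ?thesis
      proof (rule exI[of _ \<sigma>], rule exI[of _ w], intro conjI)
        show "g2 (X i s) (X i h) (X i h) + g2 (Y i s) (Y i h) (Y i h) - g2 (A s) (A h) (A h) = \<sigma>\<^sup>2 + w"
          using *(3) by (simp add: A2)
        show "\<bar>g3 (X i s) (X i h) (X i h) (X i h) + g3 (Y i s) (Y i h) (Y i h) (Y i h) - g3 (A s) (A h) (A h) (A h)\<bar>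
          \<le> 2 * (\<sigma> ^ 3 + 3 / 2 * (\<sigma> + norm \<alpha>) * w)"
        proof -
          have "\<bar>x + y - z\<bar> \<le> 2 * r" if "\<bar>- x / 2 + - y / 2 - q\<bar> \<le> r" "z = - 2 * q" for x y z q r :: real
            using that by linarith
          from this[OF *(4) A3] show ?thesis .
        qed
      qed (use * in auto)
    qed
    then have "\<forall>i\<in>UNIV - {i1}. \<exists>\<sigma> w. 0 \<le> \<sigma> \<and> 0 \<le> w
        \<and> g2 (X i s) (X i h) (X i h) + g2 (Y i s) (Y i h) (Y i h) - g2 (A s) (A h) (A h) = \<sigma>\<^sup>2 + w
        \<and> \<bar>g3 (X i s) (X i h) (X i h) (X i h) + g3 (Y i s) (Y i h) (Y i h) (Y i h) - g3 (A s) (A h) (A h) (A h)\<bar>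
          \<le> 2 * (\<sigma> ^ 3 + 3 / 2 * (\<sigma> + norm \<alpha>) * w)"
      by blast
    from bchoice[OF this] obtain \<sigma> where "\<forall>i\<in>UNIV - {i1}. \<exists>w. 0 \<le> \<sigma> i \<and> 0 \<le> w
        \<and> g2 (X i s) (X i h) (X i h) + g2 (Y i s) (Y i h) (Y i h) - g2 (A s) (A h) (A h) = (\<sigma> i)\<^sup>2 + w
        \<and> \<bar>g3 (X i s) (X i h) (X i h) (X i h) + g3 (Y i s) (Y i h) (Y i h) (Y i h) - g3 (A s) (A h) (A h) (A h)\<bar>
          \<le> 2 * ((\<sigma> i) ^ 3 + 3 / 2 * (\<sigma> i + norm \<alpha>) * w)" ..
    from bchoice[OF this] obtain w where "\<forall>i\<in>UNIV - {i1}. 0 \<le> \<sigma> i \<and> 0 \<le> w i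
        \<and> g2 (X i s) (X i h) (X i h) + g2 (Y i s) (Y i h) (Y i h) - g2 (A s) (A h) (A h) = (\<sigma> i)\<^sup>2 + w i
        \<and> \<bar>g3 (X i s) (X i h) (X i h) (X i h) + g3 (Y i s) (Y i h) (Y i h) (Y i h) - g3 (A s) (A h) (A h) (A h)\<bar>
          \<le> 2 * ((\<sigma> i) ^ 3 + 3 / 2 * (\<sigma> i + norm \<alpha>) * w i)" ..
    then have \<sigma>w: "\<And>i. i \<in> UNIV - {i1} \<Longrightarrow> 0 \<le> \<sigma> i" "\<And>i. i \<in> UNIV - {i1} \<Longrightarrow> 0 \<le> w i"
        "\<And>i. i \<in> UNIV - {i1} \<Longrightarrow> g2 (X i s) (X i h) (X i h) + g2 (Y i s) (Y i h) (Y i h) - g2 (A s) (A h) (A h) = (\<sigma> i)\<^sup>2 + w i"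
        "\<And>i. i \<in> UNIV - {i1} \<Longrightarrow> \<bar>g3 (X i s) (X i h) (X i h) (X i h) + g3 (Y i s) (Y i h) (Y i h) (Y i h) - g3 (A s) (A h) (A h) (A h)\<bar>
          \<le> 2 * ((\<sigma> i) ^ 3 + 3 / 2 * (\<sigma> i + norm \<alpha>) * w i)"
      by blast+
    have f2: "f2 s h h = (norm \<alpha>)\<^sup>2 + (\<Sum>i\<in>UNIV - {i1}. (\<sigma> i)\<^sup>2 + w i)"
      unfolding f2_def A2[symmetric] by (intro arg_cong2[of _ _ _ _ "(+)"] refl sum.cong \<sigma>w(3))
    have "\<bar>trace (\<alpha> ** \<alpha> ** \<alpha>)\<bar> \<le> norm (\<alpha> ** \<alpha>) * norm \<alpha>" by (rule abs_trace_mult_le)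
    also have "\<dots> \<le> norm \<alpha> * norm \<alpha> * norm \<alpha>" by (intro mult_right_mono norm_matrix_mult_le) simp
    finally have \<alpha>3: "\<bar>g3 (A s) (A h) (A h) (A h)\<bar> \<le> 2 * norm \<alpha> ^ 3"
      by (simp add: A3 power3_eq_cube)
    have "\<bar>f3 s h h h\<bar> \<le> \<bar>g3 (A s) (A h) (A h) (A h)\<bar> +
      (\<Sum>i\<in>UNIV - {i1}. \<bar>g3 (X i s) (X i h) (X i h) (X i h) + g3 (Y i s) (Y i h) (Y i h) (Y i h) - g3 (A s) (A h) (A h) (A h)\<bar>)"
      unfolding f3_def by (intro order_trans[OF abs_triangle_ineq] add_left_mono sum_abs)
    also have "\<dots> \<le> 2 * norm \<alpha> ^ 3 + (\<Sum>i\<in>UNIV - {i1}. 2 * ((\<sigma> i) ^ 3 + 3 / 2 * (\<sigma> i + norm \<alpha>) * w i))"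
      by (intro add_mono \<alpha>3 sum_mono \<sigma>w(4))
    also have "\<dots> = 2 * (norm \<alpha> ^ 3 + (\<Sum>i\<in>UNIV - {i1}. (\<sigma> i) ^ 3 + 3 / 2 * (\<sigma> i + norm \<alpha>) * w i))"
      by (simp only: sum_distrib_left distrib_left)
    also have "\<dots> \<le> 2 * f2 s h h powr (3/2)"
      unfolding f2 by (intro mult_left_mono self_concordance_combination \<sigma>w) simp_all
    finally show ?thesis
      using \<sigma>w(1,2) unfolding f2 by (auto intro!: add_nonneg_nonneg sum_nonneg)
  qed
  ultimately show ?thesis using that by blast
qed

lemma Fbar_barrier:
  fixes t :: "'u::finite \<Rightarrow> real^'n" and p :: "'l::finite \<Rightarrow> real^'n \<Rightarrow> real" and i1 :: "'m::finite"
  assumes X: "\<And>k. X k \<in> Kdom t p i1" and lim: "X \<longlonglongrightarrow> s" and s: "s \<notin> Kdom t p i1"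
  shows "filterlim (\<lambda>k. Fbar t p i1 (X k)) at_top sequentially"
proof -
  \<comment> \<open>A sits at the distinguished index and a Schur complement at every other one, so
    the barrier is minus one sum of logarithms.\<close>
  define M where "M i k = (if i = i1 then Lam t p (X k $ i1) else schur t p (X k $ i1) (X k $ i))" for i k
  have F: "Fbar t p i1 (X k) = - (\<Sum>i\<in>UNIV. ln (det (M i k)))" for k
  proof -
    have "(\<Sum>i\<in>UNIV. ln (det (M i k))) = ln (det (M i1 k)) + (\<Sum>i\<in>UNIV - {i1}. ln (det (M i k)))"
      by (rule sum.remove) auto
    also have "(\<Sum>i\<in>UNIV - {i1}. ln (det (M i k))) = (\<Sum>i\<in>UNIV - {i1}. ln (det (schur t p (X k $ i1) (X k $ i))))"
      by (intro sum.cong) (auto simp: M_def)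
    finally show ?thesis by (simp add: Fbar_def M_def)
  qed
  have A: "pos_def (Lam t p (X k $ i1))" for k using X[of k] by (simp add: Kdom_def)
  have pd: "pos_def (M i k)" for i k
    using X[of k] by (simp add: M_def Kdom_def)
  have limL: "(\<lambda>k. \<phi> (X k)) \<longlonglongrightarrow> \<phi> s" if "linear \<phi>" for \<phi> :: "real^'u^'m \<Rightarrow> real^'l^'l"
    using bounded_linear.tendsto[OF that[unfolded linear_conv_bounded_linear] lim] .
  note limA = limL[OF linear_Lam_nth(1)[of t p i1]]
  obtain R where R: "\<And>k. trace (Lam t p (X k $ i1)) \<le> R"
  proof -
    have "(\<lambda>k. trace (Lam t p (X k $ i1))) \<longlonglongrightarrow> trace (Lam t p (s $ i1))"
      by (rule bounded_linear.tendsto[OF bounded_linear_trace limA])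
    then have "Bseq (\<lambda>k. trace (Lam t p (X k $ i1)))"
      by (intro convergent_imp_Bseq convergentI)
    then obtain R where "\<forall>k. norm (trace (Lam t p (X k $ i1))) \<le> R"
      unfolding Bseq_def by blast
    then show ?thesis by (intro that[of R]) (simp add: abs_le_iff)
  qed
  \<comment> \<open>Schur complements have at most the trace of A, and the trace bounds the norm.
    Hence all these matrices stay in one ball even if A^-1 is unbounded along the sequence.\<close>
  have MR: "M i k \<in> cball 0 R" for i k
  proof -
    have "norm (M i k) \<le> trace (M i k)" by (rule pos_def_norm_le_trace[OF pd])
    also have "\<dots> \<le> trace (Lam t p (X k $ i1))"
      using trace_schur_le[OF A[of k] transpose_Lam[of t p "X k $ i"]] by (simp add: M_def schur_def)
    also have "\<dots> \<le> R" by (rule R)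
    finally show ?thesis by simp
  qed
  have "compact (det ` (cball 0 R :: (real^'l^'l) set))"
    by (intro compact_continuous_image continuous_on_det continuous_on_id compact_cball)
  then obtain C where C: "\<And>N :: real^'l^'l. N \<in> cball 0 R \<Longrightarrow> \<bar>det N\<bar> \<le> C"
    by (force simp: bounded_iff dest!: compact_imp_bounded)
  have "\<exists>j. (\<lambda>k. det (M j k)) \<longlonglongrightarrow> 0"
  proof (cases "det (Lam t p (s $ i1)) = 0")
    case True
    have "(\<lambda>k. det (Lam t p (X k $ i1))) \<longlonglongrightarrow> det (Lam t p (s $ i1))"
      by (rule tendsto_det[OF limA])
    with True have "(\<lambda>k. det (M i1 k)) \<longlonglongrightarrow> 0" by (simp add: M_def)
    then show ?thesis ..
  next
    \<comment> \<open>Now the limit of A is positive definite, so some A + B or A - B fails to be so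
      in the limit and becomes singular. The determinant quotient passes to the limit because its
      denominator stays away from 0.\<close>
    case False
    have "pos_def (Lam t p (s $ i1))"
      by (rule pos_def_limit[OF limA A False])
    with s obtain i where i: "i \<noteq> i1" "\<not> pos_def (Lam t p (s $ i1 + s $ i)) \<or> \<not> pos_def (Lam t p (s $ i1 - s $ i))"
      by (auto simp: Kdom_eq)
    have pds: "\<And>k. pos_def (Lam t p (X k $ i1 + X k $ i))" "\<And>k. pos_def (Lam t p (X k $ i1 - X k $ i))"
      using X i(1) by (auto simp: Kdom_eq)
    note limX = limL[OF linear_Lam_nth(2)[of t p i1 i]] and limY = limL[OF linear_Lam_nth(3)[of t p i1 i]]
    have "det (Lam t p (s $ i1 + s $ i)) = 0 \<or> det (Lam t p (s $ i1 - s $ i)) = 0"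
      using i(2) pos_def_limit[OF limX pds(1)] pos_def_limit[OF limY pds(2)]
      by blast
    moreover have "(\<lambda>k. det (Lam t p (X k $ i1 + X k $ i)) * det (Lam t p (X k $ i1 - X k $ i)) / det (Lam t p (X k $ i1)))
      \<longlonglongrightarrow> det (Lam t p (s $ i1 + s $ i)) * det (Lam t p (s $ i1 - s $ i)) / det (Lam t p (s $ i1))"
      by (intro tendsto_divide tendsto_mult tendsto_det limA limX limY False)
    ultimately have "(\<lambda>k. det (M i k)) \<longlonglongrightarrow> 0"
      using i(1) A by (auto simp: M_def det_schur_Lam)
    then show ?thesis ..
  qed
  then obtain j where j: "(\<lambda>k. det (M j k)) \<longlonglongrightarrow> 0" ..
  show ?thesis
    unfolding F
    by (rule filterlim_neg_sum_ln_at_top[where d = "\<lambda>i k. det (M i k)" and j = j and C = C])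
      (use C[OF MR] pos_def_det_pos[OF pd] j in \<open>auto simp: abs_le_iff\<close>)
qed

text \<open>A \<open>cone\<close> is also closed under scaling by 0; the origin lies in the closure
  as the limit of x / (n + 1).\<close>

lemma cone_closure_of_pos_scaling:
  fixes S :: "'a::real_normed_vector set"
  assumes S: "\<And>x c. x \<in> S \<Longrightarrow> c > 0 \<Longrightarrow> c *\<^sub>R x \<in> S" and ne: "S \<noteq> {}"
  shows "cone (closure S)"
proof -
  obtain x where x: "x \<in> S" using ne by blast
  have "(\<lambda>n. (1 / real (Suc n)) *\<^sub>R x) \<longlonglongrightarrow> 0 *\<^sub>R x"
    by (intro tendsto_scaleR tendsto_const LIMSEQ_inverse_real_of_nat[unfolded inverse_eq_divide])
  then have 0: "0 \<in> closure S"
    unfolding closure_sequential using S[OF x] by (intro exI[of _ "\<lambda>n. (1 / real (Suc n)) *\<^sub>R x"]) simp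
  have "cone (insert 0 S)"
    unfolding cone_def using S by (auto simp: order_le_less)
  then have "cone (closure (insert 0 S))" by (rule cone_closure)
  with 0 show ?thesis by (simp add: closure_insert insert_absorb)
qed

theorem theorem2:
  fixes t :: "'u::finite \<Rightarrow> real^'n"
    and p :: "'l::finite \<Rightarrow> real^'n \<Rightarrow> real"
    and d :: nat
    and i1 :: "'m::finite"
  assumes "d \<ge> 1"
    and "CARD('u) = (CARD('n) + 2 * d) choose CARD('n)"
    and "CARD('l) = (CARD('n) + d) choose CARD('n)"
    and "unisolvent (2 * d) t"
    and "poly_basis d p"
    and "CARD('m) \<ge> 2"
  shows "interior (Kdual t p i1) = Kdom t p i1 \<and>
         LHSCB (Kdual t p i1) (Fbar t p i1) (real (CARD('l) * CARD('m)))"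
proof -
  have int: "interior (Kdual t p i1) = Kdom t p i1"
    by (simp add: Kdual_def convex_interior_closure[OF convex_Kdom] interior_open[OF open_Kdom])
  \<comment> \<open>With all other components 0, both A + B and A - B equal the image of the
    all-ones vector.\<close>
  have "(\<chi> i. if i = i1 then 1 else 0) \<in> Kdom t p i1"
    using pos_def_Lam_1[OF assms(4,5)] by (simp add: Kdom_eq)
  then have ne: "Kdom t p i1 \<noteq> {}" by blast
  obtain f1 f2 f3 where f: "derivs3_on (Kdom t p i1) (Fbar t p i1) f1 f2 f3"
    and f2: "\<And>s h. s \<in> Kdom t p i1 \<Longrightarrow> f2 s h h \<ge> 0"
    and f3: "\<And>s h. s \<in> Kdom t p i1 \<Longrightarrow> \<bar>f3 s h h h\<bar> \<le> 2 * f2 s h h powr (3/2)"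
    using Fbar_derivatives[of t p i1] by blast
  have "closed (Kdual t p i1)" "convex (Kdual t p i1)" "cone (Kdual t p i1)"
    unfolding Kdual_def
    by (simp_all add: convex_closure convex_Kdom cone_closure_of_pos_scaling Kdom_scaleR ne)
  moreover have "\<exists>D1 D2 (D3 :: real^'u^'m \<Rightarrow> (real^'u^'m) \<Rightarrow>\<^sub>L (real^'u^'m) \<Rightarrow>\<^sub>L (real^'u^'m) \<Rightarrow>\<^sub>L real).
        (\<forall>x\<in>Kdom t p i1.
           (Fbar t p i1 has_derivative blinfun_apply (D1 x)) (at x) \<and>
           (D1 has_derivative blinfun_apply (D2 x)) (at x) \<and>
           (D2 has_derivative blinfun_apply (D3 x)) (at x)) \<and>
        continuous_on (Kdom t p i1) D3 \<and>
        (\<forall>x\<in>Kdom t p i1. \<forall>h.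
           \<bar>blinfun_apply (blinfun_apply (blinfun_apply (D3 x) h) h) h\<bar>
             \<le> 2 * (blinfun_apply (blinfun_apply (D2 x) h) h) powr (3/2))"
  proof -
    obtain D1 D2 and D3 :: "real^'u^'m \<Rightarrow> (real^'u^'m) \<Rightarrow>\<^sub>L (real^'u^'m) \<Rightarrow>\<^sub>L (real^'u^'m) \<Rightarrow>\<^sub>L real" where
      "\<forall>x\<in>Kdom t p i1.
           (Fbar t p i1 has_derivative blinfun_apply (D1 x)) (at x) \<and>
           (D1 has_derivative blinfun_apply (D2 x)) (at x) \<and>
           (D2 has_derivative blinfun_apply (D3 x)) (at x)"
      "continuous_on (Kdom t p i1) D3"
      "\<forall>x h. blinfun_apply (blinfun_apply (D2 x) h) h = f2 x h h"
      "\<forall>x h. blinfun_apply (blinfun_apply (blinfun_apply (D3 x) h) h) h = f3 x h h h"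
      using derivs3_on_blinfun[OF f] by blast
    with f3 show ?thesis by (intro exI[of _ D1] exI[of _ D2] exI[of _ D3]) simp
  qed
  moreover have "convex_on (Kdom t p i1) (Fbar t p i1)"
    using f convex_Kdom f2 by (rule derivs3_on_imp_convex_on)
  moreover have "filterlim (\<lambda>k. Fbar t p i1 (X k)) at_top sequentially"
    if "\<forall>k. X k \<in> Kdom t p i1" "X \<longlonglongrightarrow> x" "x \<in> frontier (Kdual t p i1)" for X x
    using that int by (intro Fbar_barrier[of X]) (auto simp: frontier_def)
  ultimately show ?thesis
    unfolding LHSCB_def int using ne Fbar_log_homogeneous[of _ t p i1] by blast
qed

end
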